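(* Let $G$ be a GO-space which is rectifiable. Then $G$ is metrizable or $G$ is a totally disconnected $P$-space.
   Context: All spaces are $T_1$ and regular. A topological space $G$ is rectifiable if there are an element $e\in G$ and a surjective homeomorphism $\varphi:G\times G\to G\times G$ such that $\pi_1\circ\varphi=\pi_1$ and $\varphi(x,x)=(x,e)$ for every $x\in G$, where $\pi_1:G\times G\to G$ is the projection to the first coordinate. A LOTS is a linearly ordered set with its open-interval topology. A GO-space (suborderable space) is a topological space homeomorphic to a subspace of a LOTS. A $P$-space is a space in which every $G_\delta$-set is open. A space is totally disconnected if each of its connected components is a single point. *)

theory Defs
  imports "HOL-Analysis.Analysis"
begin

text \<open>
  The generator \<open>L\<close> itself is only needed when \<open>L\<close> has at most one point; otherwise the open rays
  already cover \<open>L\<close>. Finite intersections of the generators are the open intervals of \<open>L\<close>,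
  bounded or not.
\<close>

definition lots_topology :: "'b set \<Rightarrow> 'b rel \<Rightarrow> 'b topology" where
  "lots_topology L r = topology_generated_by
     (insert L
       ((\<lambda>a. {x \<in> L. (x, a) \<in> r \<and> x \<noteq> a}) ` L \<union>
        (\<lambda>a. {x \<in> L. (a, x) \<in> r \<and> x \<noteq> a}) ` L))"

lemma lots_topology_UNIV:
  "lots_topology UNIV {(x, y). x \<le> y} = (euclidean :: 'b::linorder_topology topology)"
proof -
  let ?R = "range (\<lambda>a::'b. {..<a}) \<union> range (\<lambda>a. {a<..})"
  have gen: "lots_topology UNIV {(x, y). x \<le> y} = topology_generated_by (insert UNIV ?R)"
    unfolding lots_topology_def
    by (rule arg_cong[where f = topology_generated_by])
       (auto simp: less_le image_def lessThan_def greaterThan_def)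
  have "generate_topology_on (insert UNIV ?R) S \<longleftrightarrow> generate_topology ?R S" for S
  proof
    assume "generate_topology_on (insert UNIV ?R) S"
    then show "generate_topology ?R S"
    proof induction
      case Empty
      have "generate_topology ?R (\<Union>{})"
        by (rule generate_topology.UN) simp
      then show ?case by simp
    qed (auto intro: generate_topology.intros)
  next
    assume "generate_topology ?R S"
    then show "generate_topology_on (insert UNIV ?R) S"
      by induction (auto intro: generate_topology_on.intros)
  qed
  moreover have "open S \<longleftrightarrow> generate_topology ?R S" for S
    by (simp add: open_generated_order)
  ultimately show ?thesis
    unfolding gen topology_eq openin_topology_generated_by_iff open_openin[symmetric]
    by blast
qed

text \<open>
  HOL cannot quantify over types inside a formula, so the type that carries the ambient linearly
  ordered set is an explicit parameter. A theorem with the hypothesis \<open>GO_space TYPE('b) X\<close>, where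
  \<open>'b\<close> is a free type variable, covers linearly ordered sets of every type.
\<close>

definition GO_space :: "'b itself \<Rightarrow> 'a topology \<Rightarrow> bool" where
  "GO_space _ X \<longleftrightarrow>
     (\<exists>(L :: 'b set) r S. linear_order_on L r \<and> S \<subseteq> L \<and>
        X homeomorphic_space subtopology (lots_topology L r) S)"

definition rectifiable_space :: "'a topology \<Rightarrow> bool" where
  "rectifiable_space X \<longleftrightarrow>
     (\<exists>e \<in> topspace X. \<exists>\<phi>.
        homeomorphic_map (prod_topology X X) (prod_topology X X) \<phi> \<and>
        (\<forall>p \<in> topspace (prod_topology X X). fst (\<phi> p) = fst p) \<and>
        (\<forall>x \<in> topspace X. \<phi> (x, x) = (x, e)))"

definition P_space :: "'a topology \<Rightarrow> bool" where
  "P_space X \<longleftrightarrow> (\<forall>S. gdelta_in X S \<longrightarrow> openin X S)"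

definition totally_disconnected_space :: "'a topology \<Rightarrow> bool" where
  "totally_disconnected_space X \<longleftrightarrow> (\<forall>C \<in> connected_components_of X. \<exists>x. C = {x})"

end

theory Submission
  imports Defs
begin

text \<open>
  The dichotomy is whether some point of \<open>G\<close> has a countable local \<open>\<pi>\<close>-base: nonempty open sets
  \<open>U\<^sub>0, U\<^sub>1, \<dots>\<close> such that every neighbourhood of the point contains one of them (the point itself
  need not lie in any \<open>U\<^sub>n\<close>).

  Suppose that no point has one. Let \<open>x\<close> lie in open sets \<open>V\<^sub>n\<close>, taken order-convex. If the \<open>V\<^sub>n\<close> do
  not contain a common left neighbourhood of \<open>x\<close>, then \<open>x\<close> is a limit from the left and every
  \<open>s < x\<close> is missed by some \<open>V\<^sub>n\<close>; but then the left parts of the \<open>V\<^sub>n\<close> shrink to \<open>x\<close> and are a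
  countable local \<open>\<pi>\<close>-base. The same holds on the right, so \<open>\<Inter>\<^sub>n V\<^sub>n\<close> is a neighbourhood of \<open>x\<close>,
  and \<open>G\<close> is a \<open>P\<close>-space. A regular \<open>P\<close>-space has a base of clopen sets, since
  nested open sets and closed sets between them have the same intersection; hence it is totally
  disconnected.

  Suppose that the \<open>U\<^sub>n\<close> form such a \<open>\<pi>\<close>-base. The homeomorphism \<open>\<phi> (x, y) = (x, p x y)\<close> gives a
  continuous ``division'' \<open>p\<close> with \<open>p x x = e\<close>, and each \<open>p x\<close> is a homeomorphism. In a topological
  group \<open>p x y\<close> is \<open>x\<^sup>-\<^sup>1 y\<close>; as there, the sets \<open>p (U\<^sub>n \<times> U\<^sub>n)\<close> are a base of open neighbourhoods
  of \<open>e\<close>. The open sets \<open>V\<close> with \<open>p (V \<times> V) \<subseteq> p (U\<^sub>n \<times> U\<^sub>n)\<close> cover \<open>G\<close> for every \<open>n\<close>, and these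
  covers form a development (\<open>rectifiable_space_development\<close>).

  It remains to see that a developable suborderable \<open>T\<^sub>1\<close>-space is metrizable. The main point is
  that each open cover of it has a locally finite closed refinement (\<open>lf_refinable_topspace\<close>). Call \<open>x\<close> and
  \<open>y\<close> equivalent if the interval between them has such a refinement. The classes are clopen and
  convex, so it suffices to treat the part of a class \<open>C\<close> to the right of a point (and dually to
  the left). If \<open>C\<close> has a last point or countable cofinality, this part is an interval or a locally finite
  sequence of intervals. If it has neither, then at some level \<open>n\<close> of the development no member
  containing a point \<open>x \<in> C\<close> reaches arbitrarily far to the right in \<open>C\<close>: otherwise choose a bad point
  \<open>x\<^sub>n\<close> for each \<open>n\<close>; two points of \<open>C\<close> above all the \<open>x\<^sub>n\<close> could not be separated at any level. The
  finite chains of members of level \<open>n\<close> cut the space into clopen pieces, and each of them is bounded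
  in \<open>C\<close> because \<open>C\<close> has uncountable cofinality; so each lies in an interval
  that is already refined.

  A locally finite closed refinement yields an open barycentric refinement. Iterating this along the
  development gives entourages with \<open>E (n+1) \<circ> E (n+1) \<subseteq> E n\<close> that generate the topology, and the
  chain metric of Frink (\<open>metrizable_space_if_entourages\<close>) metrizes \<open>G\<close>.
\<close>

section \<open>Metrization by a sequence of entourages\<close>

text \<open>
  For decreasing relations \<open>F n\<close> the value is \<open>(1/2) ^ k\<close> for the first \<open>k\<close> at which \<open>x\<close> and \<open>y\<close> are no
  longer related, so that \<open>F n\<close> is recovered as the set where the gauge is below \<open>(1/2) ^ n\<close>.
\<close>

definition frink_gauge :: "(nat \<Rightarrow> 'a \<Rightarrow> 'a \<Rightarrow> bool) \<Rightarrow> 'a \<Rightarrow> 'a \<Rightarrow> real" where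
  "frink_gauge F x y = (if \<forall>n. F n x y then 0 else (1/2) ^ (LEAST n. \<not> F n x y))"

lemma frink_gauge_bounds: "0 \<le> frink_gauge F x y" "frink_gauge F x y \<le> 1"
  by (auto simp: frink_gauge_def power_le_one)

lemma frink_gauge_less_iff:
  assumes mono: "\<And>n x y. F (Suc n) x y \<Longrightarrow> F n x y"
  shows "frink_gauge F x y < (1/2) ^ n \<longleftrightarrow> F n x y"
proof (cases "\<forall>n. F n x y")
  case True
  then show ?thesis by (simp add: frink_gauge_def)
next
  case False
  define k where "k = (LEAST n. \<not> F n x y)"
  have nk: "\<not> F k x y"
    using False unfolding k_def by (metis (mono_tags, lifting) LeastI)
  have lk: "F m x y" if "m < k" for m
    using that not_less_Least unfolding k_def by blast
  have down: "F (m + i) x y \<Longrightarrow> F m x y" for m i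
    by (induction i) (auto dest: mono)
  have "F n x y \<longleftrightarrow> n < k"
    using nk lk down by (metis le_iff_add not_le)
  then show ?thesis
    using False unfolding frink_gauge_def k_def[symmetric] by auto
qed

text \<open>
  A weak ultrametric inequality: three steps at level \<open>n + 1\<close> make one step at level \<open>n\<close>, which
  costs a factor of two. It is stated with three steps because a chain is cut below into
  an initial part, one edge and a final part.
\<close>

lemma frink_gauge_triple:
  assumes mono: "\<And>n x y. F (Suc n) x y \<Longrightarrow> F n x y"
    and triple: "\<And>n x y z w. F (Suc n) x y \<Longrightarrow> F (Suc n) y z \<Longrightarrow> F (Suc n) z w \<Longrightarrow> F n x w"
    and le: "frink_gauge F x y \<le> a" "frink_gauge F y z \<le> a" "frink_gauge F z w \<le> a"
  shows "frink_gauge F x w \<le> 2 * a"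
proof -
  note iff = frink_gauge_less_iff[of F, OF mono]
  have step: "frink_gauge F x w < (1/2) ^ n" if "a < (1/2) ^ Suc n" for n
    using le that triple[of n x y z w] iff[of _ _ "Suc n"] iff[of _ _ n] by (meson le_less_trans)
  show ?thesis
  proof (cases "a < 1/2")
    case False
    then show ?thesis using frink_gauge_bounds(2)[of F x w] by linarith
  next
    case True
    show ?thesis
    proof (rule ccontr)
      assume neg: "\<not> ?thesis"
      define b where "b = frink_gauge F x w"
      have b: "2 * a < b" using neg by (simp add: b_def)
      have "0 \<le> a" using le(1) frink_gauge_bounds(1)[of F x y] by linarith
      then have "b \<noteq> 0" using b by simp
      then obtain k where k: "b = (1/2) ^ k"
        by (auto simp: b_def frink_gauge_def split: if_splits)
      have "a < (1/2) ^ Suc k" using b k by simp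
      from step[OF this] show False using k b_def by simp
    qed
  qed
qed

text \<open>
  The gauge violates the triangle inequality by at most a factor of two, however long the chain.
  Cut the chain at the edge where the partial sums pass half of the total: the parts before and
  after it each have sum at most half, so by induction the gauge between their ends is at most the total.
\<close>

lemma frink_gauge_chain:
  assumes mono: "\<And>n x y. F (Suc n) x y \<Longrightarrow> F n x y"
    and refl: "\<And>n x. F n x x"
    and triple: "\<And>n x y z w. F (Suc n) x y \<Longrightarrow> F (Suc n) y z \<Longrightarrow> F (Suc n) z w \<Longrightarrow> F n x w"
  shows "frink_gauge F (c 0) (c N) \<le> 2 * (\<Sum>i<N. frink_gauge F (c i) (c (Suc i)))"
proof (induction N arbitrary: c rule: less_induct)
  case (less N)
  let ?g = "frink_gauge F"
  note nn = frink_gauge_bounds(1)[of F]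
  show ?case
  proof (cases "N = 0")
    case True
    then show ?thesis using refl by (simp add: frink_gauge_def)
  next
    case False
    define s where "s j = (\<Sum>i<j. ?g (c i) (c (Suc i)))" for j
    have s_mono: "s i \<le> s j" if "i \<le> j" for i j
      unfolding s_def using that nn by (intro sum_mono2) auto
    have s0: "s 0 = 0" by (simp add: s_def)
    define K where "K = {j. j < N \<and> s j \<le> s N / 2}"
    have "0 \<le> s N" using s_mono[of 0 N] s0 by simp
    then have K: "finite K" "0 \<in> K" using False s0 by (auto simp: K_def)
    define k where "k = Max K"
    have kK: "k \<in> K" using K unfolding k_def by (intro Max_in) auto
    have kN: "k < N" "s k \<le> s N / 2" using kK by (auto simp: K_def)
    \<comment> \<open>Unless the edge from k to k + 1 is the last one, it carries the partial sum beyond one half.\<close>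
    have tail: "s N - s (Suc k) \<le> s N / 2"
    proof (cases "Suc k < N")
      case True
      have "Suc k \<notin> K" using Max_ge[OF K(1), of "Suc k"] unfolding k_def[symmetric] by auto
      then show ?thesis using True by (auto simp: K_def)
    next
      case False
      then have "Suc k = N" using kN by simp
      then show ?thesis using \<open>0 \<le> s N\<close> by simp
    qed
    have a1: "?g (c 0) (c k) \<le> s N"
      using less.IH[of k c] kN unfolding s_def[symmetric] by linarith
    have a2: "?g (c k) (c (Suc k)) \<le> s N"
    proof -
      have "s (Suc k) = s k + ?g (c k) (c (Suc k))" by (simp add: s_def)
      moreover have "0 \<le> s k" using s_mono[of 0 k] s0 by simp
      ultimately show ?thesis using s_mono[of "Suc k" N] kN by simp
    qed
    have shift: "(\<Sum>i<N - Suc k. ?g (c (Suc k + i)) (c (Suc (Suc k + i)))) = s N - s (Suc k)"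
    proof -
      have "s (j + m) = s j + (\<Sum>i<m. ?g (c (j + i)) (c (Suc (j + i))))" for j m
        by (induction m) (simp_all add: s_def)
      from this[of "Suc k" "N - Suc k"] show ?thesis using kN by simp
    qed
    have a3: "?g (c (Suc k)) (c N) \<le> s N"
      using less.IH[of "N - Suc k" "\<lambda>i. c (Suc k + i)"] kN shift tail by simp
    show ?thesis
      using frink_gauge_triple[of F, OF mono triple a1 a2 a3] unfolding s_def by simp
  qed
qed

text \<open>
  The largest pseudometric below a symmetric nonnegative gauge that vanishes on the diagonal.
\<close>

definition chain_dist :: "('a \<Rightarrow> 'a \<Rightarrow> real) \<Rightarrow> 'a \<Rightarrow> 'a \<Rightarrow> real" where
  "chain_dist g x y = Inf {(\<Sum>i<N. g (c i) (c (Suc i))) | c N. c 0 = x \<and> c N = y}"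

lemma chain_dist_lower:
  assumes "\<And>x y. 0 \<le> g x y" and "c 0 = x" "c N = y"
  shows "chain_dist g x y \<le> (\<Sum>i<N. g (c i) (c (Suc i)))"
  unfolding chain_dist_def
proof (rule cInf_lower)
  show "bdd_below {(\<Sum>i<N. g (c i) (c (Suc i))) | c N. c 0 = x \<and> c N = y}"
    by (rule bdd_belowI[of _ 0]) (auto intro!: sum_nonneg assms(1))
qed (use assms in blast)

lemma chain_dist_greatest:
  assumes "\<And>c N. c 0 = x \<Longrightarrow> c N = y \<Longrightarrow> b \<le> (\<Sum>i<N. g (c i) (c (Suc i)))"
  shows "b \<le> chain_dist g x y"
  unfolding chain_dist_def
proof (rule cInf_greatest)
  define c where "c i = (if i = 0 then x else y)" for i :: nat
  have "c 0 = x \<and> c (Suc 0) = y" by (simp add: c_def)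
  then show "{(\<Sum>i<N. g (c i) (c (Suc i))) | c N. c 0 = x \<and> c N = y} \<noteq> {}" by blast
qed (use assms in blast)

lemma chain_dist_le: 
  assumes "\<And>x y. 0 \<le> g x y"
  shows "chain_dist g x y \<le> g x y"
  using chain_dist_lower[OF assms, of "\<lambda>i. if i = 0 then x else y" x "Suc 0" y] by simp

lemma chain_dist_commute_le:
  assumes nn: "\<And>x y. 0 \<le> g x y" and sym: "\<And>x y. g x y = g y x"
  shows "chain_dist g y x \<le> chain_dist g x y"
proof (rule chain_dist_greatest)
  fix c :: "nat \<Rightarrow> 'a" and N assume c: "c 0 = x" "c N = y"
  have "chain_dist g y x \<le> (\<Sum>i<N. g (c (N - i)) (c (N - Suc i)))"
    using chain_dist_lower[OF nn, of "\<lambda>i. c (N - i)" y N x] c by simp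
  also have "\<dots> = (\<Sum>i<N. g (c (Suc i)) (c i))"
    by (subst sum.nat_diff_reindex[symmetric]) (auto intro!: sum.cong simp: Suc_diff_Suc)
  also have "\<dots> = (\<Sum>i<N. g (c i) (c (Suc i)))"
    by (subst sym) simp
  finally show "chain_dist g y x \<le> (\<Sum>i<N. g (c i) (c (Suc i)))" .
qed

lemma chain_dist_triangle:
  assumes nn: "\<And>x y. 0 \<le> g x y"
  shows "chain_dist g x z \<le> chain_dist g x y + chain_dist g y z"
proof -
  have "chain_dist g x z - chain_dist g y z \<le> chain_dist g x y"
  proof (rule chain_dist_greatest)
    fix c :: "nat \<Rightarrow> 'a" and N assume c: "c 0 = x" "c N = y"
    have "chain_dist g x z - (\<Sum>i<N. g (c i) (c (Suc i))) \<le> chain_dist g y z"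
    proof (rule chain_dist_greatest)
      fix b :: "nat \<Rightarrow> 'a" and M assume b: "b 0 = y" "b M = z"
      \<comment> \<open>The chain c from x to y, followed by the chain b from y to z.\<close>
      define a where "a i = (if i \<le> N then c i else b (i - N))" for i
      have aN: "a (N + i) = b i" for i using b c by (auto simp: a_def)
      have split: "(\<Sum>i<N+m. g (a i) (a (Suc i)))
          = (\<Sum>i<N. g (c i) (c (Suc i))) + (\<Sum>i<m. g (b i) (b (Suc i)))" for m
      proof (induction m)
        case 0
        show ?case by (auto intro!: sum.cong simp: a_def)
      next
        case (Suc m)
        then show ?case using aN[of m] aN[of "Suc m"] by simp
      qed
      have "chain_dist g x z \<le> (\<Sum>i<N+M. g (a i) (a (Suc i)))"
        using aN[of M] b c by (intro chain_dist_lower nn) (auto simp: a_def)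
      then show "chain_dist g x z - (\<Sum>i<N. g (c i) (c (Suc i))) \<le> (\<Sum>i<M. g (b i) (b (Suc i)))"
        using split by simp
    qed
    then show "chain_dist g x z - chain_dist g y z \<le> (\<Sum>i<N. g (c i) (c (Suc i)))" by simp
  qed
  then show ?thesis by simp
qed

text \<open>
  The relations \<open>E (2 * n)\<close> satisfy the threefold condition of the chain estimate, since
  composing twice costs two levels. The chain distance then lies between the gauge and half of it,
  and therefore has the entourages as its basic neighbourhoods.
\<close>

theorem metrizable_space_if_entourages:
  fixes X :: "'a topology" and E :: "nat \<Rightarrow> 'a \<Rightarrow> 'a \<Rightarrow> bool"
  assumes "t1_space X"
    and refl: "\<And>n x. E n x x"
    and sym: "\<And>n x y. E n x y \<Longrightarrow> E n y x"
    and comp: "\<And>n x y z. E (Suc n) x y \<Longrightarrow> E (Suc n) y z \<Longrightarrow> E n x z"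
    and nbhd: "\<And>n x. x \<in> topspace X \<Longrightarrow> \<exists>U. openin X U \<and> x \<in> U \<and> (\<forall>y\<in>U. E n x y)"
    and base: "\<And>U x. openin X U \<Longrightarrow> x \<in> U \<Longrightarrow> \<exists>n. \<forall>y \<in> topspace X. E n x y \<longrightarrow> y \<in> U"
  shows "metrizable_space X"
proof -
  have down: "E (Suc n) x y \<Longrightarrow> E n x y" for n x y
    using comp[of n x y y] refl by blast
  have downs: "E (n + m) x y \<Longrightarrow> E n x y" for n m x y
    by (induction m) (auto dest: down)
  define F where "F n = E (2 * n)" for n
  have F_mono: "F (Suc n) x y \<Longrightarrow> F n x y" for n x y
    unfolding F_def using downs[of "2 * n" 2 x y] by simp
  have F_triple: "F n x w" if "F (Suc n) x y" "F (Suc n) y z" "F (Suc n) z w" for n x y z w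
  proof -
    have "E (Suc (2 * n)) x z" using that comp[of "Suc (2 * n)" x y z] by (simp add: F_def)
    moreover have "E (Suc (2 * n)) z w" using that down[of "Suc (2 * n)" z w] by (simp add: F_def)
    ultimately show ?thesis unfolding F_def by (rule comp)
  qed
  define g where "g = frink_gauge F"
  have nn: "0 \<le> g x y" for x y by (simp add: g_def frink_gauge_bounds)
  have g_sym: "g x y = g y x" for x y
  proof -
    have "F n x y = F n y x" for n x y using sym by (auto simp: F_def)
    then show ?thesis by (simp add: g_def frink_gauge_def)
  qed
  have g_iff: "g x y < (1/2) ^ n \<longleftrightarrow> F n x y" for x y n
    unfolding g_def by (rule frink_gauge_less_iff[of F, OF F_mono])
  define d where "d = chain_dist g"
  have dg: "d x y \<le> g x y" for x y unfolding d_def by (rule chain_dist_le[OF nn])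
  have gd: "g x y \<le> 2 * d x y" for x y
  proof -
    have "g x y / 2 \<le> d x y"
      unfolding d_def
    proof (rule chain_dist_greatest)
      fix c :: "nat \<Rightarrow> 'a" and N assume c: "c 0 = x" "c N = y"
      have "frink_gauge F (c 0) (c N) \<le> 2 * (\<Sum>i<N. frink_gauge F (c i) (c (Suc i)))"
        by (rule frink_gauge_chain[of F, OF F_mono _ F_triple]) (simp_all add: F_def refl)
      then show "g x y / 2 \<le> (\<Sum>i<N. g (c i) (c (Suc i)))"
        unfolding g_def[symmetric] using c by simp
    qed
    then show ?thesis by simp
  qed
  have small: "F n x y" if "d x y < (1/2) ^ Suc n" for n x y
    using that gd[of x y] g_iff[of x y n] by simp
  interpret Metric_space "topspace X" d
  proof
    show "0 \<le> d x y" for x y using gd[of x y] nn[of x y] by linarith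
    show "d x y = d y x" for x y
      unfolding d_def by (intro antisym chain_dist_commute_le nn g_sym)
    show "d x z \<le> d x y + d y z" for x y z
      unfolding d_def by (rule chain_dist_triangle[OF nn])
    fix x y assume xy: "x \<in> topspace X" "y \<in> topspace X"
    show "d x y = 0 \<longleftrightarrow> x = y"
    proof
      assume "x = y"
      then have "g x y = 0" by (simp add: g_def frink_gauge_def F_def refl)
      then show "d x y = 0" using dg[of x y] gd[of x y] by simp
    next
      assume d0: "d x y = 0"
      show "x = y"
      proof (rule ccontr)
        assume "x \<noteq> y"
        then obtain U where U: "openin X U" "x \<in> U" "y \<notin> U"
          using assms(1) xy unfolding t1_space_def by blast
        then obtain n where "E n x y \<longrightarrow> y \<in> U" using base xy by blast
        moreover have "F n x y" using small d0 by simp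
        then have "E n x y" using downs[of n n x y] by (simp add: F_def mult_2)
        ultimately show False using U by blast
      qed
    qed
  qed
  have "openin X U \<longleftrightarrow> openin mtopology U" for U
  proof
    assume U: "openin X U"
    show "openin mtopology U"
      unfolding openin_mtopology
    proof (intro conjI allI impI)
      show "U \<subseteq> topspace X" using U by (rule openin_subset)
      fix x assume x: "x \<in> U"
      obtain n where n: "\<forall>y \<in> topspace X. E n x y \<longrightarrow> y \<in> U" using base[OF U x] by blast
      have "mball x ((1/2) ^ Suc n) \<subseteq> U"
        using n small[of x _ n] downs[of n n x] by (auto simp: F_def mult_2)
      then show "\<exists>r>0. mball x r \<subseteq> U" by (intro exI[of _ "(1/2) ^ Suc n"]) simp
    qed
  next
    assume U: "openin mtopology U"
    show "openin X U"
    proof (subst openin_subopen, intro ballI)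
      fix x assume x: "x \<in> U"
      then obtain r where r: "r > 0" "mball x r \<subseteq> U" and xX: "x \<in> topspace X"
        using U unfolding openin_mtopology by blast
      obtain n where n: "(1/2::real) ^ n < r"
        using r(1) real_arch_pow_inv[of r "1/2"] by auto
      obtain V where V: "openin X V" "x \<in> V" "\<forall>y\<in>V. E (2 * n) x y" using nbhd[OF xX] by blast
      have "V \<subseteq> mball x r"
      proof
        fix y assume "y \<in> V"
        then have "y \<in> topspace X" "F n x y" using V openin_subset by (auto simp: F_def)
        then show "y \<in> mball x r"
          using xX n g_iff[of x y n] dg[of x y] by simp
      qed
      then show "\<exists>T. openin X T \<and> x \<in> T \<and> T \<subseteq> U" using V r by blast
    qed
  qed
  then have "X = mtopology" by (simp add: topology_eq)
  then show ?thesis using metrizable_space_mtopology by simp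
qed

section \<open>Locally finite closed refinements\<close>

text \<open>
  The subsets that satisfy this for a fixed \<open>\<V>\<close> form an ideal of closed sets that is closed under locally finite
  unions, which is how the property is extended from intervals to the whole space.
\<close>

definition lf_refinable :: "'a topology \<Rightarrow> 'a set set \<Rightarrow> 'a set \<Rightarrow> bool" where
  "lf_refinable X \<V> A \<longleftrightarrow> (\<exists>\<F>. locally_finite_in X \<F> \<and> \<Union>\<F> = A \<and>
     (\<forall>F\<in>\<F>. closedin X F \<and> (\<exists>V\<in>\<V>. F \<subseteq> V)))"

lemma lf_refinable_single:
  assumes "closedin X A" "V \<in> \<V>" "A \<subseteq> V"
  shows "lf_refinable X \<V> A"
  unfolding lf_refinable_def
  using assms closedin_subset[OF assms(1)]
  by (intro exI[of _ "{A}"]) (auto intro!: finite_imp_locally_finite_in)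

lemma lf_refinable_mono:
  assumes "lf_refinable X \<V> A" and sub: "\<And>V. V \<in> \<V> \<Longrightarrow> \<exists>U\<in>\<U>. V \<subseteq> U"
  shows "lf_refinable X \<U> A"
proof -
  obtain \<F> where F: "locally_finite_in X \<F> \<and> \<Union>\<F> = A \<and>
     (\<forall>F\<in>\<F>. closedin X F \<and> (\<exists>V\<in>\<V>. F \<subseteq> V))"
    using assms(1) unfolding lf_refinable_def by (rule exE)
  have "\<exists>U\<in>\<U>. F \<subseteq> U" if "F \<in> \<F>" for F
    using F sub that by (meson subset_trans)
  then show ?thesis
    unfolding lf_refinable_def using F by (intro exI[of _ \<F>]) simp
qed

lemma lf_refinable_subset:
  assumes "lf_refinable X \<V> A" "closedin X B" "B \<subseteq> A"
  shows "lf_refinable X \<V> B"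
proof -
  obtain \<F> where F: "locally_finite_in X \<F>" "\<Union>\<F> = A"
    "\<And>F. F \<in> \<F> \<Longrightarrow> closedin X F" "\<And>F. F \<in> \<F> \<Longrightarrow> \<exists>V\<in>\<V>. F \<subseteq> V"
    using assms(1) unfolding lf_refinable_def by blast
  show ?thesis
    unfolding lf_refinable_def
  proof (intro exI conjI)
    show "locally_finite_in X ((\<lambda>F. F \<inter> B) ` \<F>)"
      by (rule locally_finite_in_refinement[OF F(1)]) auto
    show "\<Union>((\<lambda>F. F \<inter> B) ` \<F>) = B" using F(2) assms(3) by blast
    show "\<forall>F\<in>(\<lambda>F. F \<inter> B) ` \<F>. closedin X F \<and> (\<exists>V\<in>\<V>. F \<subseteq> V)"
    proof
      fix G assume "G \<in> (\<lambda>F. F \<inter> B) ` \<F>"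
      then obtain F where "F \<in> \<F>" "G = F \<inter> B" by blast
      then show "closedin X G \<and> (\<exists>V\<in>\<V>. G \<subseteq> V)"
        using F(3,4)[of F] assms(2) by blast
    qed
  qed
qed

text \<open>
  The chosen refinement of each \<open>A \<in> \<A>\<close> consists of subsets of \<open>A\<close>. Hence near a point only the
  finitely many \<open>A\<close> that meet a neighbourhood matter, and finitely many neighbourhoods can be intersected.
\<close>

lemma lf_refinable_Union:
  assumes lf: "locally_finite_in X \<A>" and ref: "\<And>A. A \<in> \<A> \<Longrightarrow> lf_refinable X \<V> A"
  shows "lf_refinable X \<V> (\<Union>\<A>)"
proof -
  have "\<forall>A\<in>\<A>. \<exists>\<F>. locally_finite_in X \<F> \<and> \<Union>\<F> = A \<and>
     (\<forall>F\<in>\<F>. closedin X F \<and> (\<exists>V\<in>\<V>. F \<subseteq> V))"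
    using ref unfolding lf_refinable_def by simp
  then obtain \<F> where F: "\<forall>A\<in>\<A>. locally_finite_in X (\<F> A) \<and> \<Union>(\<F> A) = A \<and>
     (\<forall>F\<in>\<F> A. closedin X F \<and> (\<exists>V\<in>\<V>. F \<subseteq> V))"
    by (rule bchoice[THEN exE])
  have F_lf: "locally_finite_in X (\<F> A)" and F_Un: "\<Union>(\<F> A) = A" if "A \<in> \<A>" for A
    using F that by blast+
  have "locally_finite_in X (\<Union>A\<in>\<A>. \<F> A)"
    unfolding locally_finite_in_def
  proof (intro conjI ballI)
    have "A \<subseteq> topspace X" if "A \<in> \<A>" for A
      using lf that by (auto simp: locally_finite_in_def)
    then show "\<Union>(\<Union>A\<in>\<A>. \<F> A) \<subseteq> topspace X"
      using F_Un by blast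
    fix x assume x: "x \<in> topspace X"
    obtain V where V: "openin X V" "x \<in> V" "finite {A \<in> \<A>. A \<inter> V \<noteq> {}}"
      using lf x by (auto simp: locally_finite_in_def)
    define \<B> where "\<B> = {A \<in> \<A>. A \<inter> V \<noteq> {}}"
    have "\<forall>A\<in>\<B>. \<exists>U. openin X U \<and> x \<in> U \<and> finite {B \<in> \<F> A. B \<inter> U \<noteq> {}}"
      using F_lf x by (simp add: locally_finite_in_def \<B>_def)
    then obtain U where U: "\<And>A. A \<in> \<B> \<Longrightarrow> openin X (U A) \<and> x \<in> U A \<and> finite {B \<in> \<F> A. B \<inter> U A \<noteq> {}}"
      by metis
    \<comment> \<open>Intersecting with the whole space covers the case that no member of the family meets V.\<close>
    define W where "W = V \<inter> (topspace X \<inter> \<Inter>(U ` \<B>))"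
    have "openin X (topspace X \<inter> \<Inter>(U ` \<B>))"
      using U V(3) unfolding \<B>_def[symmetric] by (intro openin_Int_Inter) auto
    then have "openin X W" unfolding W_def using V(1) by blast
    moreover have "x \<in> W" using V(2) U x by (auto simp: W_def)
    moreover have "{B \<in> (\<Union>A\<in>\<A>. \<F> A). B \<inter> W \<noteq> {}} \<subseteq> (\<Union>A\<in>\<B>. {B \<in> \<F> A. B \<inter> U A \<noteq> {}})"
    proof
      fix B assume "B \<in> {B \<in> (\<Union>A\<in>\<A>. \<F> A). B \<inter> W \<noteq> {}}"
      then obtain A where A: "A \<in> \<A>" "B \<in> \<F> A" "B \<inter> W \<noteq> {}" by blast
      then have "B \<subseteq> A" using F_Un by blast
      then have "A \<in> \<B>" using A by (auto simp: \<B>_def W_def)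
      then show "B \<in> (\<Union>A\<in>\<B>. {B \<in> \<F> A. B \<inter> U A \<noteq> {}})" using A by (auto simp: W_def)
    qed
    then have "finite {B \<in> (\<Union>A\<in>\<A>. \<F> A). B \<inter> W \<noteq> {}}"
      by (rule finite_subset) (use V(3) U in \<open>auto simp: \<B>_def[symmetric]\<close>)
    ultimately show "\<exists>V. openin X V \<and> x \<in> V \<and> finite {U \<in> (\<Union>A\<in>\<A>. \<F> A). U \<inter> V \<noteq> {}}"
      by blast
  qed
  moreover have "\<Union>(\<Union>A\<in>\<A>. \<F> A) = (\<Union>A\<in>\<A>. \<Union>(\<F> A))" by blast
  then have "\<Union>(\<Union>A\<in>\<A>. \<F> A) = \<Union>\<A>" using F_Un by simp
  moreover have "\<forall>B\<in>(\<Union>A\<in>\<A>. \<F> A). closedin X B \<and> (\<exists>V\<in>\<V>. B \<subseteq> V)"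
    using F by simp
  ultimately show ?thesis
    unfolding lf_refinable_def by (intro exI[of _ "\<Union>A\<in>\<A>. \<F> A"] conjI)
qed

lemma lf_refinable_Un:
  assumes "lf_refinable X \<V> A" "lf_refinable X \<V> B"
  shows "lf_refinable X \<V> (A \<union> B)"
proof -
  have "S \<subseteq> topspace X" if "lf_refinable X \<V> S" for S
    using that unfolding lf_refinable_def locally_finite_in_def by metis
  then have "\<Union>{A, B} \<subseteq> topspace X" using assms by simp
  then have "locally_finite_in X {A, B}" by (intro finite_imp_locally_finite_in) simp_all
  then have "lf_refinable X \<V> (\<Union>{A, B})" by (rule lf_refinable_Union) (use assms in auto)
  then show ?thesis by simp
qed

lemma locally_finite_in_if_disjoint_open:
  assumes "\<And>D. D \<in> \<D> \<Longrightarrow> openin X D" "pairwise disjnt \<D>" "topspace X \<subseteq> \<Union>\<D>"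
  shows "locally_finite_in X \<D>"
  unfolding locally_finite_in_def
proof (intro conjI ballI)
  show "\<Union>\<D> \<subseteq> topspace X" using assms(1) openin_subset by blast
  fix x assume "x \<in> topspace X"
  then obtain D where D: "D \<in> \<D>" "x \<in> D" using assms(3) by blast
  have "{U \<in> \<D>. U \<inter> D \<noteq> {}} \<subseteq> {D}"
    using assms(2) D(1) by (auto simp: pairwise_def disjnt_def)
  then have "finite {U \<in> \<D>. U \<inter> D \<noteq> {}}" by (rule finite_subset) simp
  then show "\<exists>V. openin X V \<and> x \<in> V \<and> finite {U \<in> \<D>. U \<inter> V \<noteq> {}}"
    using D assms(1) by blast
qed

text \<open>
  Let \<open>F \<subseteq> v F \<in> \<V>\<close> for the members \<open>F\<close> of the refinement. The neighbourhood \<open>W x\<close> lies in all \<open>v F\<close>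
  with \<open>x \<in> F\<close> and avoids all \<open>F\<close> with \<open>x \<notin> F\<close>. If \<open>z \<in> F\<close>, then \<open>z \<in> W x\<close> is only possible for
  \<open>x \<in> F\<close>, and so \<open>v F\<close> contains the whole star of \<open>z\<close>.
\<close>

lemma lf_refinable_imp_barycentric:
  assumes op: "\<And>V. V \<in> \<V> \<Longrightarrow> openin X V" and ref: "lf_refinable X \<V> (topspace X)"
  shows "\<exists>\<W>. (\<forall>W\<in>\<W>. openin X W) \<and> topspace X \<subseteq> \<Union>\<W> \<and>
    (\<forall>z\<in>topspace X. \<exists>V\<in>\<V>. \<forall>W\<in>\<W>. z \<in> W \<longrightarrow> W \<subseteq> V)"
proof -
  obtain \<F> where F: "locally_finite_in X \<F> \<and> \<Union>\<F> = topspace X \<and>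
     (\<forall>F\<in>\<F>. closedin X F \<and> (\<exists>V\<in>\<V>. F \<subseteq> V))"
    using ref unfolding lf_refinable_def by (rule exE)
  then have lf: "locally_finite_in X \<F>" and U: "\<Union>\<F> = topspace X"
    and cl: "\<And>F. F \<in> \<F> \<Longrightarrow> closedin X F" and in_V: "\<forall>F\<in>\<F>. \<exists>V. V \<in> \<V> \<and> F \<subseteq> V"
    by (simp_all add: Bex_def)
  obtain v where v: "\<forall>F\<in>\<F>. v F \<in> \<V> \<and> F \<subseteq> v F"
    using bchoice[OF in_V] by blast
  define W where "W x = (topspace X \<inter> \<Inter>(v ` {F \<in> \<F>. x \<in> F})) - \<Union>{F \<in> \<F>. x \<notin> F}" for x
  have "openin X (W x)" if x: "x \<in> topspace X" for x
  proof -
    obtain N where N: "x \<in> N" "finite {F \<in> \<F>. F \<inter> N \<noteq> {}}"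
      using lf x unfolding locally_finite_in_def by blast
    have "finite {F \<in> \<F>. x \<in> F}" by (rule finite_subset[OF _ N(2)]) (use N(1) in auto)
    then have "openin X (topspace X \<inter> \<Inter>(v ` {F \<in> \<F>. x \<in> F}))"
      using v op by (intro openin_Int_Inter) auto
    moreover have "closedin X (\<Union>{F \<in> \<F>. x \<notin> F})"
      by (rule closedin_locally_finite_Union) (auto intro: cl locally_finite_in_subset[OF lf])
    ultimately show ?thesis unfolding W_def by (rule openin_diff)
  qed
  moreover have "x \<in> W x" if "x \<in> topspace X" for x
    using that v by (auto simp: W_def)
  moreover have "\<exists>V\<in>\<V>. \<forall>A\<in>W ` topspace X. z \<in> A \<longrightarrow> A \<subseteq> V" if z: "z \<in> topspace X" for z
  proof -
    obtain F where F: "F \<in> \<F>" "z \<in> F" using z U by blast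
    have "W x \<subseteq> v F" if "z \<in> W x" for x
      using that F by (auto simp: W_def)
    then show ?thesis using v F(1) by blast
  qed
  ultimately show ?thesis by (intro exI[of _ "W ` topspace X"]) blast
qed

section \<open>Developments of rectifiable spaces\<close>

text \<open>
  The second components of \<open>\<phi>\<close> and of its inverse. In a topological group one can take
  \<open>p x y = x\<^sup>-\<^sup>1 y\<close> and \<open>q x y = x y\<close>; the cancellation laws below are what remains of the group structure.
\<close>

lemma rectifiable_space_division:
  assumes "rectifiable_space X"
  obtains e p q where
    "continuous_map (prod_topology X X) X (\<lambda>(x, y). p x y)"
    "continuous_map (prod_topology X X) X (\<lambda>(x, y). q x y)"
    "\<And>x. x \<in> topspace X \<Longrightarrow> p x x = e"
    "\<And>x y. x \<in> topspace X \<Longrightarrow> y \<in> topspace X \<Longrightarrow> q x (p x y) = y"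
    "\<And>x y. x \<in> topspace X \<Longrightarrow> y \<in> topspace X \<Longrightarrow> p x (q x y) = y"
proof -
  let ?P = "prod_topology X X"
  obtain e \<phi> where h: "homeomorphic_map ?P ?P \<phi>"
    and f: "\<And>z. z \<in> topspace ?P \<Longrightarrow> fst (\<phi> z) = fst z"
    and d: "\<And>x. x \<in> topspace X \<Longrightarrow> \<phi> (x, x) = (x, e)"
    using assms unfolding rectifiable_space_def by blast
  obtain \<psi> where hm: "homeomorphic_maps ?P ?P \<phi> \<psi>"
    using h homeomorphic_map_maps by blast
  have c: "continuous_map ?P ?P \<phi>" "continuous_map ?P ?P \<psi>"
    and i: "\<And>z. z \<in> topspace ?P \<Longrightarrow> \<psi> (\<phi> z) = z" "\<And>z. z \<in> topspace ?P \<Longrightarrow> \<phi> (\<psi> z) = z"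
    using hm by (auto simp: homeomorphic_maps_def)
  have in\<phi>: "\<phi> z \<in> topspace ?P" and in\<psi>: "\<psi> z \<in> topspace ?P" if "z \<in> topspace ?P" for z
    using c that by (auto simp: continuous_map_def Pi_iff)
  have f': "fst (\<psi> z) = fst z" if "z \<in> topspace ?P" for z
    using f[OF in\<psi>[OF that]] i(2)[OF that] by simp
  show thesis
  proof (rule that[of "\<lambda>x y. snd (\<phi> (x, y))" "\<lambda>x y. snd (\<psi> (x, y))" e])
    show "continuous_map ?P X (\<lambda>(x, y). snd (\<phi> (x, y)))"
      using continuous_map_compose[OF c(1) continuous_map_snd] by (simp add: comp_def case_prod_beta')
    show "continuous_map ?P X (\<lambda>(x, y). snd (\<psi> (x, y)))"
      using continuous_map_compose[OF c(2) continuous_map_snd] by (simp add: comp_def case_prod_beta')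
    show "snd (\<phi> (x, x)) = e" if "x \<in> topspace X" for x using d[OF that] by simp
    fix x y assume "x \<in> topspace X" "y \<in> topspace X"
    then have xy: "(x, y) \<in> topspace ?P" by simp
    have "\<phi> (x, y) = (x, snd (\<phi> (x, y)))" "\<psi> (x, y) = (x, snd (\<psi> (x, y)))"
      using f[OF xy] f'[OF xy] by (simp_all add: prod_eq_iff)
    then show "snd (\<psi> (x, snd (\<phi> (x, y)))) = y" "snd (\<phi> (x, snd (\<psi> (x, y)))) = y"
      using i[OF xy] by (metis snd_conv)+
  qed
qed

text \<open>
  The sets \<open>W n = p (U n \<times> U n)\<close> are neighbourhoods of \<open>e\<close> since \<open>p\<close> maps the diagonal to \<open>e\<close>, even though
  \<open>x0\<close> may lie outside of \<open>U n\<close>; by continuity of \<open>p\<close> at \<open>(x0, x0)\<close> they form a base at \<open>e\<close>. A set \<open>V\<close> in the \<open>n\<close>-th cover that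
  contains \<open>x\<close> is mapped into \<open>W n\<close> by the homeomorphism \<open>p x\<close>, and so it lies in a prescribed
  neighbourhood of \<open>x\<close> once \<open>W n\<close> is small enough.
\<close>

theorem rectifiable_space_development:
  assumes "rectifiable_space X" and x0: "x0 \<in> topspace X"
    and U: "\<And>n::nat. openin X (U n)" "\<And>n. U n \<noteq> {}"
    and pi: "\<And>T. openin X T \<Longrightarrow> x0 \<in> T \<Longrightarrow> \<exists>n. U n \<subseteq> T"
  shows "\<exists>\<V> :: nat \<Rightarrow> 'a set set. (\<forall>n. (\<forall>V\<in>\<V> n. openin X V) \<and> topspace X \<subseteq> \<Union>(\<V> n)) \<and>
    (\<forall>T x. openin X T \<longrightarrow> x \<in> T \<longrightarrow> (\<exists>n. \<forall>V\<in>\<V> n. x \<in> V \<longrightarrow> V \<subseteq> T))"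
proof -
  obtain e p q where
    cp: "continuous_map (prod_topology X X) X (\<lambda>(x, y). p x y)" and
    cq: "continuous_map (prod_topology X X) X (\<lambda>(x, y). q x y)" and
    pe: "\<And>x. x \<in> topspace X \<Longrightarrow> p x x = e" and
    qp: "\<And>x y. x \<in> topspace X \<Longrightarrow> y \<in> topspace X \<Longrightarrow> q x (p x y) = y" and
    pq: "\<And>x y. x \<in> topspace X \<Longrightarrow> y \<in> topspace X \<Longrightarrow> p x (q x y) = y"
    using rectifiable_space_division[OF assms(1)] by metis
  have pX: "p x y \<in> topspace X" if "x \<in> topspace X" "y \<in> topspace X" for x y
    using cp that by (auto simp: continuous_map_def Pi_iff)
  have p_image: "openin X (p x ` T)" if x: "x \<in> topspace X" and T: "openin X T" for x T
  proof -
    have "continuous_map X (prod_topology X X) (\<lambda>y. (x, y))"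
      using x by (simp add: continuous_map_pairedI)
    from continuous_map_compose[OF this cq] have "continuous_map X X (q x)"
      by (simp add: comp_def)
    then have "openin X {w \<in> topspace X. q x w \<in> T}"
      using T by (rule openin_continuous_map_preimage)
    moreover have "{w \<in> topspace X. q x w \<in> T} = p x ` T"
    proof (intro subset_antisym subsetI)
      fix w assume "w \<in> {w \<in> topspace X. q x w \<in> T}"
      then show "w \<in> p x ` T" using pq[OF x, of w] by (metis (mono_tags) image_eqI mem_Collect_eq)
    next
      fix w assume "w \<in> p x ` T"
      then obtain t where t: "t \<in> T" "w = p x t" by blast
      then have "t \<in> topspace X" using T openin_subset by blast
      then show "w \<in> {w \<in> topspace X. q x w \<in> T}" using t pX[OF x] qp[OF x] by simp
    qed
    ultimately show ?thesis by simp
  qed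
  have square: "\<exists>V. openin X V \<and> y \<in> V \<and> (\<forall>a\<in>V. \<forall>b\<in>V. p a b \<in> T)"
    if y: "y \<in> topspace X" and T: "openin X T" "e \<in> T" for y T
  proof -
    have "openin (prod_topology X X) {z \<in> topspace (prod_topology X X). (case z of (x, y) \<Rightarrow> p x y) \<in> T}"
      using cp T(1) by (rule openin_continuous_map_preimage)
    moreover have "(y, y) \<in> {z \<in> topspace (prod_topology X X). (case z of (x, y) \<Rightarrow> p x y) \<in> T}"
      using y T(2) pe by simp
    ultimately have "\<exists>A B. openin X A \<and> openin X B \<and> y \<in> A \<and> y \<in> B \<and>
      A \<times> B \<subseteq> {z \<in> topspace (prod_topology X X). (case z of (x, y) \<Rightarrow> p x y) \<in> T}"
      unfolding openin_prod_topology_alt by meson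
    then obtain A B where "openin X A" "openin X B" "y \<in> A" "y \<in> B"
      "A \<times> B \<subseteq> {z \<in> topspace (prod_topology X X). (case z of (x, y) \<Rightarrow> p x y) \<in> T}"
      by blast
    then show ?thesis by (intro exI[of _ "A \<inter> B"]) auto
  qed
  define W where "W n = (\<Union>a\<in>U n. p a ` U n)" for n
  have UX: "U n \<subseteq> topspace X" for n using U(1) openin_subset by blast
  have W_open: "openin X (W n)" for n
    unfolding W_def using p_image[OF subsetD[OF UX] U(1)] by (intro openin_Union) auto
  have W_e: "e \<in> W n" for n
  proof -
    obtain a where "a \<in> U n" using U(2) by blast
    then show ?thesis using pe[of a] UX unfolding W_def by (metis UN_I image_eqI subsetD)
  qed
  have W_base: "\<exists>n. W n \<subseteq> T" if T: "openin X T" "e \<in> T" for T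
  proof -
    obtain V where V: "openin X V" "x0 \<in> V" "\<forall>a\<in>V. \<forall>b\<in>V. p a b \<in> T" using square[OF x0 T] by blast
    obtain n where "U n \<subseteq> V" using pi V by blast
    then have "W n \<subseteq> T" using V(3) by (auto simp: W_def)
    then show ?thesis ..
  qed
  define \<V> where "\<V> n = {V. openin X V \<and> (\<forall>a\<in>V. \<forall>b\<in>V. p a b \<in> W n)}" for n
  have "topspace X \<subseteq> \<Union>(\<V> n)" for n
  proof
    fix y assume y: "y \<in> topspace X"
    obtain V where "openin X V" "y \<in> V" "\<forall>a\<in>V. \<forall>b\<in>V. p a b \<in> W n"
      using square[OF y W_open[of n] W_e[of n]] by blast
    then show "y \<in> \<Union>(\<V> n)" by (auto simp: \<V>_def)
  qed
  moreover have "\<exists>n. \<forall>V\<in>\<V> n. x \<in> V \<longrightarrow> V \<subseteq> T" if T: "openin X T" "x \<in> T" for T x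
  proof -
    have x: "x \<in> topspace X" using T openin_subset by blast
    have "e \<in> p x ` T" using T(2) pe[OF x] by (metis image_eqI)
    then obtain n where n: "W n \<subseteq> p x ` T" using W_base p_image[OF x T(1)] by blast
    have "V \<subseteq> T" if V: "V \<in> \<V> n" "x \<in> V" for V
    proof
      fix z assume z: "z \<in> V"
      have zX: "z \<in> topspace X" using z V(1) openin_subset unfolding \<V>_def by blast
      have "p x z \<in> p x ` T" using V z n unfolding \<V>_def by blast
      then obtain t where t: "t \<in> T" "p x z = p x t" by blast
      moreover have "t \<in> topspace X" using t(1) T(1) openin_subset by blast
      ultimately have "z = t" using qp[OF x zX] qp[OF x, of t] by metis
      then show "z \<in> T" using t by simp
    qed
    then show ?thesis by blast
  qed
  ultimately show ?thesis by (intro exI[of _ \<V>]) (auto simp: \<V>_def)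
qed

section \<open>Suborderable spaces\<close>

text \<open>
  Convexity, like \<open>between\<close> below, takes the order as a parameter and is invariant under reversing
  it, so that a result about the right side of a point can be used for the reversed order.
\<close>

definition order_convex :: "'a topology \<Rightarrow> ('a \<Rightarrow> 'a \<Rightarrow> bool) \<Rightarrow> 'a set \<Rightarrow> bool" where
  "order_convex X le S \<longleftrightarrow> (\<forall>a\<in>S. \<forall>b\<in>S. \<forall>c\<in>topspace X. le a c \<longrightarrow> le c b \<longrightarrow> c \<in> S)"

definition between :: "'a topology \<Rightarrow> ('a \<Rightarrow> 'a \<Rightarrow> bool) \<Rightarrow> 'a \<Rightarrow> 'a \<Rightarrow> 'a set" where
  "between X le a b = {z \<in> topspace X. le a z \<and> le z b \<or> le b z \<and> le z a}"

lemma order_convexD: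
  "order_convex X le S \<Longrightarrow> a \<in> S \<Longrightarrow> b \<in> S \<Longrightarrow> c \<in> topspace X \<Longrightarrow> le a c \<Longrightarrow> le c b \<Longrightarrow> c \<in> S"
  unfolding order_convex_def by blast

lemma between_commute: "between X le a b = between X le b a"
  by (auto simp: between_def)

lemma between_subset_convex:
  "order_convex X le S \<Longrightarrow> a \<in> S \<Longrightarrow> b \<in> S \<Longrightarrow> between X le a b \<subseteq> S"
  unfolding between_def order_convex_def by blast

lemma order_convex_dual: "order_convex X (\<lambda>x y. le y x) S \<longleftrightarrow> order_convex X le S"
  unfolding order_convex_def by blast

lemma between_dual: "between X (\<lambda>x y. le y x) a b = between X le a b"
  by (auto simp: between_def)

text \<open>
  The order is total on the whole type and not just on the carrier of the space. This spares carrier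
  conditions in all reasoning about the order, and every linear order on the carrier extends to the type.
\<close>

locale suborderable = linorder less_eq less
  for less_eq :: "'a \<Rightarrow> 'a \<Rightarrow> bool" (infix "\<sqsubseteq>" 50) and less (infix "\<sqsubset>" 50) +
  fixes X :: "'a topology"
  assumes open_below: "a \<in> topspace X \<Longrightarrow> openin X {x \<in> topspace X. x \<sqsubset> a}"
    and open_above: "a \<in> topspace X \<Longrightarrow> openin X {x \<in> topspace X. a \<sqsubset> x}"
    and convex_base: "openin X U \<Longrightarrow> x \<in> U \<Longrightarrow>
      \<exists>V. openin X V \<and> x \<in> V \<and> V \<subseteq> U \<and> order_convex X (\<sqsubseteq>) V"
begin

lemma dual: "suborderable (\<lambda>x y. y \<sqsubseteq> x) (\<lambda>x y. y \<sqsubset> x) X"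
proof (intro suborderable.intro suborderable_axioms.intro)
  show "class.linorder (\<lambda>x y. y \<sqsubseteq> x) (\<lambda>x y. y \<sqsubset> x)" by (rule dual_linorder)
  show "openin X {x \<in> topspace X. a \<sqsubset> x}" if "a \<in> topspace X" for a
    using that by (rule open_above)
  show "openin X {x \<in> topspace X. x \<sqsubset> a}" if "a \<in> topspace X" for a
    using that by (rule open_below)
  show "\<exists>V. openin X V \<and> x \<in> V \<and> V \<subseteq> U \<and> order_convex X (\<lambda>x y. y \<sqsubseteq> x) V"
    if "openin X U" "x \<in> U" for U x
    unfolding order_convex_dual[of X "(\<sqsubseteq>)"] using that by (rule convex_base)
qed

lemma closed_above: "a \<in> topspace X \<Longrightarrow> closedin X {x \<in> topspace X. a \<sqsubseteq> x}"
proof -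
  assume "a \<in> topspace X"
  moreover have "{x \<in> topspace X. a \<sqsubseteq> x} = topspace X - {x \<in> topspace X. x \<sqsubset> a}" by auto
  ultimately show ?thesis using open_below by (metis closedin_diff closedin_topspace)
qed

lemma closed_below: "a \<in> topspace X \<Longrightarrow> closedin X {x \<in> topspace X. x \<sqsubseteq> a}"
proof -
  assume "a \<in> topspace X"
  moreover have "{x \<in> topspace X. x \<sqsubseteq> a} = topspace X - {x \<in> topspace X. a \<sqsubset> x}" by auto
  ultimately show ?thesis using open_above by (metis closedin_diff closedin_topspace)
qed

lemma closed_between:
  assumes "a \<in> topspace X" "b \<in> topspace X"
  shows "closedin X (between X (\<sqsubseteq>) a b)"
proof -
  have "between X (\<sqsubseteq>) a b =
    {x \<in> topspace X. a \<sqsubseteq> x} \<inter> {x \<in> topspace X. x \<sqsubseteq> b} \<union>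
    {x \<in> topspace X. b \<sqsubseteq> x} \<inter> {x \<in> topspace X. x \<sqsubseteq> a}"
    by (auto simp: between_def)
  then show ?thesis using assms closed_above closed_below by (simp add: closedin_Int closedin_Un)
qed

lemma between_triangle: "between X (\<sqsubseteq>) a c \<subseteq> between X (\<sqsubseteq>) a b \<union> between X (\<sqsubseteq>) b c"
  unfolding between_def using linear by blast

text \<open>
  The case of uncountable cofinality. No member of \<open>\<D>\<close> reaches from a point \<open>x\<close> of \<open>C\<close> past a suitable larger
  point \<open>s x\<close> of \<open>C\<close>, so a chain of \<open>k\<close> members of \<open>\<D>\<close> that starts at \<open>d\<close> stays below the \<open>k\<close>-th
  iterate of \<open>s\<close> at \<open>d\<close>. These iterates have an upper bound in \<open>C\<close>. Hence each chain class of \<open>\<D>\<close> meets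
  the part of \<open>C\<close> above \<open>a\<close> inside an interval, and the chain classes are clopen.
\<close>

lemma bounded_chain_classes:
  assumes op: "\<And>V. V \<in> \<D> \<Longrightarrow> openin X V" and cv: "\<And>V. V \<in> \<D> \<Longrightarrow> order_convex X (\<sqsubseteq>) V"
    and cover: "topspace X \<subseteq> \<Union>\<D>"
    and C: "closedin X C" and a: "a \<in> C"
    and gap: "\<And>x. x \<in> C \<Longrightarrow> \<exists>y\<in>C. x \<sqsubset> y \<and> \<not> (\<exists>V\<in>\<D>. x \<in> V \<and> y \<in> V)"
    and nseq: "\<And>c :: nat \<Rightarrow> 'a. range c \<subseteq> C \<Longrightarrow> \<exists>y\<in>C. \<forall>k. c k \<sqsubset> y"
    and good: "\<And>x y. x \<in> C \<Longrightarrow> y \<in> C \<Longrightarrow> lf_refinable X \<V> (between X (\<sqsubseteq>) x y)"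
  shows "lf_refinable X \<V> {z \<in> C. a \<sqsubseteq> z}"
proof -
  have CX: "C \<subseteq> topspace X" using C closedin_subset by blast
  define near where "near x y \<longleftrightarrow> (\<exists>V\<in>\<D>. x \<in> V \<and> y \<in> V)" for x y
  define D where "D x = {y. near\<^sup>*\<^sup>* x y}" for x
  have near_sym: "symp near" by (auto simp: symp_def near_def)
  have D_refl: "x \<in> D x" for x by (simp add: D_def)
  have D_eq: "D x = D y" if "y \<in> D x" for x y
  proof -
    have xy: "near\<^sup>*\<^sup>* x y" "near\<^sup>*\<^sup>* y x"
      using that near_sym by (auto simp: D_def dest: sympD[OF symp_rtranclp])
    then show ?thesis unfolding D_def by (auto intro: rtranclp_trans)
  qed
  have D_open: "openin X (D x)" if "x \<in> topspace X" for x
  proof (subst openin_subopen, intro ballI)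
    fix y assume y: "y \<in> D x"
    have "y \<in> topspace X"
      using y[unfolded D_def mem_Collect_eq] that
      by (induction rule: rtranclp_induct) (use op openin_subset in \<open>auto simp: near_def\<close>)
    then obtain V where V: "V \<in> \<D>" "y \<in> V" using cover by blast
    have "V \<subseteq> D y"
    proof
      fix z assume "z \<in> V"
      then have "near y z" using V unfolding near_def by blast
      then show "z \<in> D y" by (simp add: D_def r_into_rtranclp)
    qed
    then show "\<exists>T. openin X T \<and> y \<in> T \<and> T \<subseteq> D x" using V op D_eq[OF y] by auto
  qed
  have D_sub: "D x \<subseteq> topspace X" if "x \<in> topspace X" for x
    using openin_subset[OF D_open[OF that]] .
  have D_disj: "D x = D y" if "z \<in> D x" "z \<in> D y" for x y z
    using D_eq[OF that(1)] D_eq[OF that(2)] by simp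
  have D_closed: "closedin X (D x)" if x: "x \<in> topspace X" for x
    unfolding closedin_def
  proof (intro conjI D_sub x, subst openin_subopen, intro ballI)
    fix y assume y: "y \<in> topspace X - D x"
    have "D y \<inter> D x = {}" using D_disj y D_refl by (metis DiffD2 disjoint_iff)
    then show "\<exists>T. openin X T \<and> y \<in> T \<and> T \<subseteq> topspace X - D x"
      using D_open[of y] D_refl[of y] D_sub[of y] y by (intro exI[of _ "D y"]) auto
  qed
  let ?S = "{z \<in> C. a \<sqsubseteq> z}"
  have S: "closedin X ?S"
  proof -
    have "?S = C \<inter> {x \<in> topspace X. a \<sqsubseteq> x}" using CX by auto
    then show ?thesis using C closed_above a CX by (metis closedin_Int subsetD)
  qed
  have lf: "locally_finite_in X ((\<lambda>B. B \<inter> ?S) ` D ` topspace X)"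
  proof (rule locally_finite_in_refinement[OF locally_finite_in_if_disjoint_open])
    show "openin X B" if "B \<in> D ` topspace X" for B using that D_open by auto
    show "pairwise disjnt (D ` topspace X)"
      unfolding pairwise_def disjnt_def using D_disj by blast
    show "topspace X \<subseteq> \<Union> (D ` topspace X)" using D_refl by auto
  qed auto
  have "lf_refinable X \<V> (D x \<inter> ?S)" if x: "x \<in> topspace X" for x
  proof -
    have "\<exists>c\<in>C. D x \<inter> ?S \<subseteq> between X (\<sqsubseteq>) a c"
    proof (cases "D x \<inter> ?S = {}")
      case True
      then show ?thesis using a by (metis empty_subsetI)
    next
      case False
      then obtain d where d: "d \<in> D x" "d \<in> C" by blast
      obtain s where s: "\<And>x. x \<in> C \<Longrightarrow> s x \<in> C \<and> x \<sqsubset> s x \<and> \<not> near x (s x)"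
        using gap unfolding near_def by metis
      have it: "(s ^^ k) d \<in> C" for k by (induction k) (use d s in auto)
      then obtain c where c: "c \<in> C" "\<And>k. (s ^^ k) d \<sqsubset> c"
        using nseq[of "\<lambda>k. (s ^^ k) d"] by blast
      have reach: "\<exists>k. z \<sqsubseteq> (s ^^ k) d" if "near\<^sup>*\<^sup>* d z" for z
        using that
      proof (induction rule: rtranclp_induct)
        case base
        show ?case by (rule exI[of _ 0]) simp
      next
        case (step y z)
        then obtain k where k: "y \<sqsubseteq> (s ^^ k) d" by blast
        let ?u = "(s ^^ k) d"
        have u: "s ?u \<in> C" "?u \<sqsubset> s ?u" "\<not> near ?u (s ?u)" using s it by blast+
        have "z \<sqsubseteq> s ?u"
        proof (rule ccontr)
          assume "\<not> z \<sqsubseteq> s ?u"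
          then have z: "s ?u \<sqsubseteq> z" by (simp add: local.not_le)
          obtain V where V: "V \<in> \<D>" "y \<in> V" "z \<in> V" using step.hyps(2) by (auto simp: near_def)
          \<comment> \<open>The link from y to z would jump over both u and s u, which lie in no common member.\<close>
          have "?u \<in> V"
            by (rule order_convexD[OF cv[OF V(1)] V(2,3)])
               (use it CX k u z in \<open>auto intro: local.order.trans local.less_imp_le\<close>)
          moreover have "s ?u \<in> V"
            by (rule order_convexD[OF cv[OF V(1)] V(2,3)])
               (use it CX k u z in \<open>auto intro: local.order.trans local.less_imp_le\<close>)
          ultimately show False using u(3) V(1) by (auto simp: near_def)
        qed
        then show ?case by (intro exI[of _ "Suc k"]) simp
      qed
      have "D x = D d" by (rule D_eq[OF d(1)])
      have "z \<sqsubseteq> c" if "z \<in> D x" for z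
      proof -
        have "z \<in> D d" using that \<open>D x = D d\<close> by simp
        then have "near\<^sup>*\<^sup>* d z" by (simp add: D_def)
        then obtain k where "z \<sqsubseteq> (s ^^ k) d" using reach by blast
        then show ?thesis using c(2)[of k] local.le_less_trans local.less_imp_le by blast
      qed
      then have "D x \<inter> ?S \<subseteq> between X (\<sqsubseteq>) a c" using CX by (auto simp: between_def)
      then show ?thesis using c(1) by blast
    qed
    then obtain c where c: "c \<in> C" "D x \<inter> ?S \<subseteq> between X (\<sqsubseteq>) a c" by blast
    show ?thesis
      by (rule lf_refinable_subset[OF good[OF a c(1)] closedin_Int[OF D_closed[OF x] S] c(2)])
  qed
  then have "lf_refinable X \<V> (\<Union>((\<lambda>B. B \<inter> ?S) ` D ` topspace X))"
    by (intro lf_refinable_Union[OF lf]) auto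
  moreover have "\<Union>((\<lambda>B. B \<inter> ?S) ` D ` topspace X) = ?S" using D_refl CX by auto
  ultimately show ?thesis by simp
qed

text \<open>
  With countable cofinality there is a strictly increasing cofinal sequence that starts at \<open>a\<close>. The
  intervals between its consecutive terms are locally finite: initial segments of the carrier are open and meet only
  finitely many of them, and the complement of \<open>C\<close> meets none.
\<close>

lemma lf_refinable_cofinal_sequence:
  assumes C: "openin X C" "closedin X C" "order_convex X (\<sqsubseteq>) C" and a: "a \<in> C"
    and nmax: "\<And>m. m \<in> C \<Longrightarrow> \<exists>c\<in>C. m \<sqsubset> c"
    and cof: "range c \<subseteq> C" "\<And>y. y \<in> C \<Longrightarrow> \<exists>k::nat. y \<sqsubseteq> c k"
    and good: "\<And>x y. x \<in> C \<Longrightarrow> y \<in> C \<Longrightarrow> lf_refinable X \<V> (between X (\<sqsubseteq>) x y)"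
  shows "lf_refinable X \<V> {z \<in> C. a \<sqsubseteq> z}"
proof -
  have CX: "C \<subseteq> topspace X" using C closedin_subset by blast
  have "\<exists>z\<in>C. x \<sqsubset> z \<and> c k \<sqsubseteq> z" if x: "x \<in> C" for x k
  proof -
    have "c k \<in> C" using cof(1) by blast
    then obtain m where m: "m \<in> C" "x \<sqsubseteq> m" "c k \<sqsubseteq> m" using x linear order_refl by metis
    then obtain z where "z \<in> C" "m \<sqsubset> z" using nmax by blast
    then show ?thesis using m(2,3) by (meson le_less_trans less_imp_le)
  qed
  then obtain s where s: "\<And>x k. x \<in> C \<Longrightarrow> s x k \<in> C \<and> x \<sqsubset> s x k \<and> c k \<sqsubseteq> s x k" by metis
  define b where "b = rec_nat a (\<lambda>k x. s x k)"
  have b0: "b 0 = a" and bS: "b (Suc k) = s (b k) k" for k by (simp_all add: b_def)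
  have bC: "b k \<in> C" for k by (induction k) (use a s in \<open>auto simp: b0 bS\<close>)
  have b_step: "b k \<sqsubset> b (Suc k)" for k using s[OF bC] by (simp add: bS)
  have b_mono: "b i \<sqsubseteq> b j" if "i \<le> j" for i j
    using that by (induction rule: dec_induct) (auto intro: local.order.trans local.less_imp_le b_step)
  have b_cof: "\<exists>k. y \<sqsubset> b k" if "y \<in> C" for y
  proof -
    obtain k where "y \<sqsubseteq> c k" using cof(2) \<open>y \<in> C\<close> by blast
    then have "y \<sqsubseteq> b (Suc k)" using s[OF bC, of k k] by (auto simp: bS intro: local.order.trans)
    then show ?thesis using b_step local.le_less_trans by blast
  qed
  define I where "I k = between X (\<sqsubseteq>) (b k) (b (Suc k))" for k
  have I_eq: "I k = {z \<in> topspace X. b k \<sqsubseteq> z \<and> z \<sqsubseteq> b (Suc k)}" for k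
    using b_step[of k] by (auto simp: I_def between_def)
  have IC: "I k \<subseteq> C" for k unfolding I_def by (rule between_subset_convex[OF C(3) bC bC])
  have lf: "locally_finite_in X (range I)"
    unfolding locally_finite_in_def
  proof (intro conjI ballI)
    show "\<Union>(range I) \<subseteq> topspace X" by (auto simp: I_eq)
    fix x assume x: "x \<in> topspace X"
    show "\<exists>V. openin X V \<and> x \<in> V \<and> finite {U \<in> range I. U \<inter> V \<noteq> {}}"
    proof (cases "x \<in> C")
      case False
      have none: "{U \<in> range I. U \<inter> (topspace X - C) \<noteq> {}} = {}" using IC by blast
      have "finite {U \<in> range I. U \<inter> (topspace X - C) \<noteq> {}}" unfolding none by simp
      moreover have "openin X (topspace X - C)" "x \<in> topspace X - C"
        using False C(2) x by (simp_all add: closedin_def)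
      ultimately show ?thesis by blast
    next
      case True
      then obtain k where k: "x \<sqsubset> b k" using b_cof by blast
      have "{U \<in> range I. U \<inter> {z \<in> topspace X. z \<sqsubset> b k} \<noteq> {}} \<subseteq> I ` {..<k}"
      proof
        fix U assume "U \<in> {U \<in> range I. U \<inter> {z \<in> topspace X. z \<sqsubset> b k} \<noteq> {}}"
        then obtain j z where j: "U = I j" "z \<in> I j" "z \<sqsubset> b k" by blast
        have "\<not> k \<le> j"
          using j(2,3) b_mono[of k j] by (auto simp: I_eq dest: local.order.trans local.leD)
        then show "U \<in> I ` {..<k}" using j(1) by auto
      qed
      then have "finite {U \<in> range I. U \<inter> {z \<in> topspace X. z \<sqsubset> b k} \<noteq> {}}"
        by (rule finite_subset) simp
      moreover have "openin X {z \<in> topspace X. z \<sqsubset> b k}" using open_below bC CX by blast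
      moreover have "x \<in> {z \<in> topspace X. z \<sqsubset> b k}" using k x by simp
      ultimately show ?thesis by blast
    qed
  qed
  have U: "\<Union>(range I) = {z \<in> C. a \<sqsubseteq> z}"
  proof (intro subset_antisym subsetI)
    fix z assume "z \<in> \<Union>(range I)"
    then obtain k where k: "z \<in> I k" by blast
    then have "z \<in> C" "b k \<sqsubseteq> z" using IC by (auto simp: I_eq)
    then show "z \<in> {z \<in> C. a \<sqsubseteq> z}" using b_mono[of 0 k] b0 by (auto intro: local.order.trans)
  next
    fix z assume z: "z \<in> {z \<in> C. a \<sqsubseteq> z}"
    define k where "k = (LEAST k. z \<sqsubset> b k)"
    have k: "z \<sqsubset> b k" using b_cof z unfolding k_def by (metis (mono_tags, lifting) LeastI_ex mem_Collect_eq)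
    have "k \<noteq> 0" using k b0 z by (metis (mono_tags) mem_Collect_eq not_le)
    then obtain j where j: "k = Suc j" using not0_implies_Suc by blast
    then have "\<not> z \<sqsubset> b j" using not_less_Least[of j "\<lambda>k. z \<sqsubset> b k"] by (simp add: k_def)
    then have "z \<in> I j" using k z CX by (auto simp: I_eq j local.not_less local.less_imp_le)
    then show "z \<in> \<Union>(range I)" by blast
  qed
  have "lf_refinable X \<V> (\<Union>(range I))"
    using lf by (rule lf_refinable_Union) (use good bC I_def in auto)
  then show ?thesis by (simp add: U)
qed

text \<open>
  The separation property says that the covers \<open>\<D> n\<close> witness a \<open>G\<^sub>\<delta>\<close>-diagonal. It is
  used where \<open>C\<close> has neither a last point nor a cofinal sequence.
\<close>

lemma lf_refinable_above:
  fixes \<D> :: "nat \<Rightarrow> 'a set set"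
  assumes C: "openin X C" "closedin X C" "order_convex X (\<sqsubseteq>) C" and a: "a \<in> C"
    and good: "\<And>x y. x \<in> C \<Longrightarrow> y \<in> C \<Longrightarrow> lf_refinable X \<V> (between X (\<sqsubseteq>) x y)"
    and op: "\<And>n V. V \<in> \<D> n \<Longrightarrow> openin X V" and cv: "\<And>n V. V \<in> \<D> n \<Longrightarrow> order_convex X (\<sqsubseteq>) V"
    and cover: "\<And>n. topspace X \<subseteq> \<Union>(\<D> n)"
    and sep: "\<And>x y. x \<in> topspace X \<Longrightarrow> y \<in> topspace X \<Longrightarrow> x \<noteq> y \<Longrightarrow> \<exists>n. \<not> (\<exists>V\<in>\<D> n. x \<in> V \<and> y \<in> V)"
  shows "lf_refinable X \<V> {z \<in> C. a \<sqsubseteq> z}"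
proof -
  have CX: "C \<subseteq> topspace X" using C closedin_subset by blast
  consider m where "m \<in> C" "\<forall>c\<in>C. c \<sqsubseteq> m"
    | c :: "nat \<Rightarrow> 'a" where "\<forall>m\<in>C. \<exists>c\<in>C. m \<sqsubset> c" "range c \<subseteq> C" "\<forall>y\<in>C. \<exists>k. y \<sqsubseteq> c k"
    | "\<forall>m\<in>C. \<exists>c\<in>C. m \<sqsubset> c" "\<forall>c :: nat \<Rightarrow> 'a. range c \<subseteq> C \<longrightarrow> (\<exists>y\<in>C. \<forall>k. c k \<sqsubset> y)"
    using local.not_le by metis
  then show ?thesis
  proof cases
    case 1
    have "closedin X ({x \<in> topspace X. a \<sqsubseteq> x} \<inter> C)" using C(2) closed_above a CX by blast
    moreover have "{x \<in> topspace X. a \<sqsubseteq> x} \<inter> C = {z \<in> C. a \<sqsubseteq> z}" using CX by auto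
    moreover have "{z \<in> C. a \<sqsubseteq> z} \<subseteq> between X (\<sqsubseteq>) a m"
      using 1 CX by (auto simp: between_def)
    ultimately show ?thesis using lf_refinable_subset[OF good[OF a 1(1)]] by metis
  next
    case (2 c)
    show ?thesis by (rule lf_refinable_cofinal_sequence[OF C a _ 2(2) _ good]) (use 2 in auto)
  next
    case 3
    have "\<exists>n. \<forall>x\<in>C. \<exists>y\<in>C. x \<sqsubset> y \<and> \<not> (\<exists>V\<in>\<D> n. x \<in> V \<and> y \<in> V)"
    proof (rule ccontr)
      \<comment> \<open>For each n the point x n then shares a member of level n with every larger point of C.\<close>
      assume "\<not> ?thesis"
      then obtain x where x: "\<And>n. x n \<in> C" "\<And>n y. y \<in> C \<Longrightarrow> x n \<sqsubset> y \<Longrightarrow> \<exists>V\<in>\<D> n. x n \<in> V \<and> y \<in> V"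
        by metis
      have "range x \<subseteq> C" using x(1) by blast
      then obtain y where y: "y \<in> C" "\<And>n. x n \<sqsubset> y" using 3(2) by metis
      obtain z where z: "z \<in> C" "y \<sqsubset> z" using 3(1) y by blast
      obtain n where n: "\<not> (\<exists>V\<in>\<D> n. y \<in> V \<and> z \<in> V)"
        using sep[of y z] y z CX by auto
      have "x n \<sqsubset> z" using y(2) z(2) by (rule local.less_trans)
      then obtain V where V: "V \<in> \<D> n" "x n \<in> V" "z \<in> V" using x(2) z(1) by blast
      have "y \<in> V"
        by (rule order_convexD[OF cv[OF V(1)] V(2,3)]) (use y z CX in \<open>auto intro: local.less_imp_le\<close>)
      then show False using n V by blast
    qed
    then obtain n where n: "\<forall>x\<in>C. \<exists>y\<in>C. x \<sqsubset> y \<and> \<not> (\<exists>V\<in>\<D> n. x \<in> V \<and> y \<in> V)" by (rule exE)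
    show ?thesis
    proof (rule bounded_chain_classes[OF op cv cover[of n] C(2) a _ _ good])
      show "\<exists>y\<in>C. x \<sqsubset> y \<and> \<not> (\<exists>V\<in>\<D> n. x \<in> V \<and> y \<in> V)" if "x \<in> C" for x
        using n that by (rule bspec)
      show "\<exists>y\<in>C. \<forall>k. c k \<sqsubset> y" if "range c \<subseteq> C" for c :: "nat \<Rightarrow> 'a"
        using 3(2) that by simp
    qed
  qed
qed

lemma lf_refinable_below:
  fixes \<D> :: "nat \<Rightarrow> 'a set set"
  assumes C: "openin X C" "closedin X C" "order_convex X (\<sqsubseteq>) C" and a: "a \<in> C"
    and good: "\<And>x y. x \<in> C \<Longrightarrow> y \<in> C \<Longrightarrow> lf_refinable X \<V> (between X (\<sqsubseteq>) x y)"
    and op: "\<And>n V. V \<in> \<D> n \<Longrightarrow> openin X V" and cv: "\<And>n V. V \<in> \<D> n \<Longrightarrow> order_convex X (\<sqsubseteq>) V"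
    and cover: "\<And>n. topspace X \<subseteq> \<Union>(\<D> n)"
    and sep: "\<And>x y. x \<in> topspace X \<Longrightarrow> y \<in> topspace X \<Longrightarrow> x \<noteq> y \<Longrightarrow> \<exists>n. \<not> (\<exists>V\<in>\<D> n. x \<in> V \<and> y \<in> V)"
  shows "lf_refinable X \<V> {z \<in> C. z \<sqsubseteq> a}"
proof (rule suborderable.lf_refinable_above[OF dual C(1,2) _ a _ op _ cover sep])
  show "order_convex X (\<lambda>x y. y \<sqsubseteq> x) C"
    unfolding order_convex_dual[of X "(\<sqsubseteq>)"] by (rule C(3))
  show "order_convex X (\<lambda>x y. y \<sqsubseteq> x) V" if "V \<in> \<D> n" for V n
    unfolding order_convex_dual[of X "(\<sqsubseteq>)"] using that by (rule cv)
  show "lf_refinable X \<V> (between X (\<lambda>x y. y \<sqsubseteq> x) x y)" if "x \<in> C" "y \<in> C" for x y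
    unfolding between_dual[of X "(\<sqsubseteq>)"] using that by (rule good)
qed

text \<open>
  This is the core of the fact that suborderable spaces with a \<open>G\<^sub>\<delta>\<close>-diagonal are paracompact. Points with a refinable
  interval between them are equivalent, because the interval from \<open>x\<close> to \<open>z\<close> lies in the union of the
  intervals from \<open>x\<close> to \<open>y\<close> and from \<open>y\<close> to \<open>z\<close>. Points in a common member of \<open>\<V>\<close> are
  equivalent, so the classes are open.
\<close>

theorem lf_refinable_topspace:
  fixes \<D> :: "nat \<Rightarrow> 'a set set"
  assumes V: "\<And>V. V \<in> \<V> \<Longrightarrow> openin X V" "\<And>V. V \<in> \<V> \<Longrightarrow> order_convex X (\<sqsubseteq>) V" "topspace X \<subseteq> \<Union>\<V>"
    and op: "\<And>n V. V \<in> \<D> n \<Longrightarrow> openin X V" and cv: "\<And>n V. V \<in> \<D> n \<Longrightarrow> order_convex X (\<sqsubseteq>) V"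
    and cover: "\<And>n. topspace X \<subseteq> \<Union>(\<D> n)"
    and sep: "\<And>x y. x \<in> topspace X \<Longrightarrow> y \<in> topspace X \<Longrightarrow> x \<noteq> y \<Longrightarrow> \<exists>n. \<not> (\<exists>V\<in>\<D> n. x \<in> V \<and> y \<in> V)"
  shows "lf_refinable X \<V> (topspace X)"
proof -
  define R where "R x y \<longleftrightarrow> lf_refinable X \<V> (between X (\<sqsubseteq>) x y)" for x y
  define C where "C x = {y \<in> topspace X. R x y}" for x
  have near: "R x y" if "W \<in> \<V>" "x \<in> W" "y \<in> W" for W x y
    unfolding R_def
    using that V(1)[OF that(1)] between_subset_convex[OF V(2)[OF that(1)]]
    by (intro lf_refinable_single[OF closed_between]) (auto dest: openin_subset)
  have R_sym: "R x y \<Longrightarrow> R y x" for x y by (simp add: R_def between_commute)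
  have R_trans: "R x z" if "R x y" "R y z" "x \<in> topspace X" "z \<in> topspace X" for x y z
    using that unfolding R_def
    by (metis lf_refinable_subset lf_refinable_Un closed_between between_triangle)
  have C_refl: "x \<in> C x" if "x \<in> topspace X" for x
    using V(3) near that unfolding C_def by blast
  have C_open: "openin X (C x)" if x: "x \<in> topspace X" for x
  proof (subst openin_subopen, intro ballI)
    fix y assume y: "y \<in> C x"
    then obtain W where W: "W \<in> \<V>" "y \<in> W" using V(3) by (auto simp: C_def)
    have "W \<subseteq> C x"
    proof
      fix z assume z: "z \<in> W"
      then have "z \<in> topspace X" using V(1)[OF W(1)] openin_subset by blast
      moreover have "R x y" "y \<in> topspace X" using y by (simp_all add: C_def)
      ultimately show "z \<in> C x" using R_trans[OF _ near[OF W z] x] by (simp add: C_def)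
    qed
    then show "\<exists>T. openin X T \<and> y \<in> T \<and> T \<subseteq> C x" using W V(1) by blast
  qed
  have C_disj: "C x = C y" if "z \<in> C x" "z \<in> C y" "x \<in> topspace X" "y \<in> topspace X" for x y z
  proof -
    have mono: "C u \<subseteq> C v" if "R v u" "v \<in> topspace X" for u v
      using R_trans[OF that(1) _ that(2)] by (auto simp: C_def)
    have "R x z" "R y z" using that(1,2) by (simp_all add: C_def)
    then have "R x y" using R_trans[OF _ R_sym that(3,4)] by blast
    then show ?thesis using mono[of x y] mono[of y x] R_sym that(3,4) by blast
  qed
  have C_sub: "C x \<subseteq> topspace X" for x by (auto simp: C_def)
  have C_closed: "closedin X (C x)" if x: "x \<in> topspace X" for x
    unfolding closedin_def
  proof (intro conjI C_sub, subst openin_subopen, intro ballI)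
    fix y assume y: "y \<in> topspace X - C x"
    then have "C y \<inter> C x = {}" using C_disj[of _ y x] C_refl[of y] x by auto
    then show "\<exists>T. openin X T \<and> y \<in> T \<and> T \<subseteq> topspace X - C x"
      using C_open[of y] C_refl[of y] C_sub[of y] y by (intro exI[of _ "C y"]) auto
  qed
  have C_good: "R y z" if "y \<in> C x" "z \<in> C x" "x \<in> topspace X" for x y z
  proof -
    have "R x y" "R x z" "y \<in> topspace X" "z \<in> topspace X" using that(1,2) by (simp_all add: C_def)
    then show ?thesis using R_trans[OF R_sym, of x y z] by blast
  qed
  have C_convex: "order_convex X (\<sqsubseteq>) (C x)" if x: "x \<in> topspace X" for x
    unfolding order_convex_def
  proof (intro ballI impI)
    fix u v w assume u: "u \<in> C x" and v: "v \<in> C x" and w: "w \<in> topspace X" "u \<sqsubseteq> w" "w \<sqsubseteq> v"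
    have "between X (\<sqsubseteq>) u w \<subseteq> between X (\<sqsubseteq>) u v"
      using w by (auto simp: between_def intro: local.order.trans)
    moreover have "u \<in> topspace X" using u C_sub by blast
    ultimately have "R u w"
      using lf_refinable_subset closed_between w(1) C_good[OF u v x] unfolding R_def by metis
    moreover have "R x u" using u by (simp add: C_def)
    ultimately show "w \<in> C x" using R_trans[OF _ _ x w(1)] w(1) by (simp add: C_def)
  qed
  have "lf_refinable X \<V> (C x)" if x: "x \<in> topspace X" for x
  proof -
    have good: "\<And>y z. y \<in> C x \<Longrightarrow> z \<in> C x \<Longrightarrow> lf_refinable X \<V> (between X (\<sqsubseteq>) y z)"
      using C_good x unfolding R_def by blast
    have "lf_refinable X \<V> {z \<in> C x. x \<sqsubseteq> z}"
      using C_open[OF x] C_closed[OF x] C_convex[OF x] C_refl[OF x] good op cv cover sep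
      by (rule lf_refinable_above)
    moreover have "lf_refinable X \<V> {z \<in> C x. z \<sqsubseteq> x}"
      using C_open[OF x] C_closed[OF x] C_convex[OF x] C_refl[OF x] good op cv cover sep
      by (rule lf_refinable_below)
    ultimately have "lf_refinable X \<V> ({z \<in> C x. x \<sqsubseteq> z} \<union> {z \<in> C x. z \<sqsubseteq> x})"
      by (rule lf_refinable_Un)
    moreover have "{z \<in> C x. x \<sqsubseteq> z} \<union> {z \<in> C x. z \<sqsubseteq> x} = C x" using linear by auto
    ultimately show ?thesis by simp
  qed
  moreover have "locally_finite_in X (C ` topspace X)"
  proof (rule locally_finite_in_if_disjoint_open)
    show "openin X D" if "D \<in> C ` topspace X" for D using that C_open by auto
    show "pairwise disjnt (C ` topspace X)"
      unfolding pairwise_def disjnt_def using C_disj by blast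
    show "topspace X \<subseteq> \<Union>(C ` topspace X)" using C_refl by auto
  qed
  ultimately have "lf_refinable X \<V> (\<Union>(C ` topspace X))"
    by (intro lf_refinable_Union) auto
  moreover have "\<Union>(C ` topspace X) = topspace X" using C_refl C_sub by blast
  ultimately show ?thesis by simp
qed

definition convex_refinement :: "'a set set \<Rightarrow> 'a set set" where
  "convex_refinement \<U> = {V. openin X V \<and> order_convex X (\<sqsubseteq>) V \<and> (\<exists>U\<in>\<U>. V \<subseteq> U)}"

lemma convex_refinement_covers:
  assumes "\<And>U. U \<in> \<U> \<Longrightarrow> openin X U" "topspace X \<subseteq> \<Union>\<U>"
  shows "topspace X \<subseteq> \<Union>(convex_refinement \<U>)"
proof
  fix x assume "x \<in> topspace X"
  then obtain U where U: "U \<in> \<U>" "x \<in> U" using assms(2) by blast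
  obtain V where "openin X V \<and> x \<in> V \<and> V \<subseteq> U \<and> order_convex X (\<sqsubseteq>) V"
    using convex_base[OF assms(1)[OF U(1)] U(2)] by (rule exE)
  then show "x \<in> \<Union>(convex_refinement \<U>)" using U(1) unfolding convex_refinement_def by blast
qed

text \<open>
  Passing to convex open subsets of the members keeps a cover a cover and preserves the
  separation of points by the covers \<open>\<D> n\<close>.
\<close>

lemma open_barycentric_refinement:
  fixes \<D> :: "nat \<Rightarrow> 'a set set"
  assumes U: "\<And>U. U \<in> \<U> \<Longrightarrow> openin X U" "topspace X \<subseteq> \<Union>\<U>"
    and op: "\<And>n V. V \<in> \<D> n \<Longrightarrow> openin X V"
    and cover: "\<And>n. topspace X \<subseteq> \<Union>(\<D> n)"
    and sep: "\<And>x y. x \<in> topspace X \<Longrightarrow> y \<in> topspace X \<Longrightarrow> x \<noteq> y \<Longrightarrow> \<exists>n. \<not> (\<exists>V\<in>\<D> n. x \<in> V \<and> y \<in> V)"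
  shows "\<exists>\<W>. (\<forall>W\<in>\<W>. openin X W) \<and> topspace X \<subseteq> \<Union>\<W> \<and>
    (\<forall>z\<in>topspace X. \<exists>U\<in>\<U>. \<forall>W\<in>\<W>. z \<in> W \<longrightarrow> W \<subseteq> U)"
proof -
  have "lf_refinable X (convex_refinement \<U>) (topspace X)"
  proof (rule lf_refinable_topspace[where \<D> = "\<lambda>n. convex_refinement (\<D> n)"])
    show "topspace X \<subseteq> \<Union>(convex_refinement \<U>)" by (rule convex_refinement_covers[OF U])
    show "topspace X \<subseteq> \<Union>(convex_refinement (\<D> n))" for n
      by (rule convex_refinement_covers[OF op cover])
    fix x y assume "x \<in> topspace X" "y \<in> topspace X" "x \<noteq> y"
    then obtain n where n: "\<not> (\<exists>V\<in>\<D> n. x \<in> V \<and> y \<in> V)" using sep by blast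
    have "\<not> (\<exists>V\<in>convex_refinement (\<D> n). x \<in> V \<and> y \<in> V)"
      using n unfolding convex_refinement_def by blast
    then show "\<exists>n. \<not> (\<exists>V\<in>convex_refinement (\<D> n). x \<in> V \<and> y \<in> V)" by (rule exI)
  qed (simp_all add: convex_refinement_def)
  then have "lf_refinable X \<U> (topspace X)"
  proof (rule lf_refinable_mono)
    show "\<exists>U\<in>\<U>. V \<subseteq> U" if "V \<in> convex_refinement \<U>" for V
      using that by (simp add: convex_refinement_def)
  qed
  then show ?thesis using lf_refinable_imp_barycentric[OF U(1)] by simp
qed

text \<open>
  Refine barycentrically again and again, meeting the \<open>n\<close>-th cover with \<open>\<D> n\<close> first. Two
  members that share a point lie in the star of that point, which gives the composition property of the
  entourages; the factor \<open>\<D> n\<close> makes them generate the topology.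
\<close>

theorem metrizable_if_development:
  fixes \<D> :: "nat \<Rightarrow> 'a set set"
  assumes t1: "t1_space X"
    and op: "\<And>n V. V \<in> \<D> n \<Longrightarrow> openin X V"
    and cover: "\<And>n. topspace X \<subseteq> \<Union>(\<D> n)"
    and base: "\<And>T x. openin X T \<Longrightarrow> x \<in> T \<Longrightarrow> \<exists>n. \<forall>V\<in>\<D> n. x \<in> V \<longrightarrow> V \<subseteq> T"
  shows "metrizable_space X"
proof -
  have sep: "\<exists>n. \<not> (\<exists>V\<in>\<D> n. x \<in> V \<and> y \<in> V)"
    if xy: "x \<in> topspace X" "y \<in> topspace X" "x \<noteq> y" for x y
  proof -
    obtain T where T: "openin X T" "x \<in> T" "y \<notin> T" using t1 xy unfolding t1_space_def by metis
    obtain n where "\<forall>V\<in>\<D> n. x \<in> V \<longrightarrow> V \<subseteq> T" using base[OF T(1,2)] by (rule exE)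
    then show ?thesis using T(3) by blast
  qed
  define cov where "cov \<U> \<longleftrightarrow> (\<forall>U\<in>\<U>. openin X U) \<and> topspace X \<subseteq> \<Union>\<U>" for \<U>
  have "\<exists>\<W>. cov \<W> \<and> (\<forall>z\<in>topspace X. \<exists>U\<in>\<U>. \<forall>W\<in>\<W>. z \<in> W \<longrightarrow> W \<subseteq> U)" if "cov \<U>" for \<U>
    using open_barycentric_refinement[OF _ _ op cover sep, of \<U>] that unfolding cov_def by simp
  then have "\<forall>\<U>. \<exists>\<W>. cov \<U> \<longrightarrow> cov \<W> \<and> (\<forall>z\<in>topspace X. \<exists>U\<in>\<U>. \<forall>W\<in>\<W>. z \<in> W \<longrightarrow> W \<subseteq> U)"
    by simp
  then obtain B where B: "\<forall>\<U>. cov \<U> \<longrightarrow> cov (B \<U>) \<and>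
      (\<forall>z\<in>topspace X. \<exists>U\<in>\<U>. \<forall>W\<in>B \<U>. z \<in> W \<longrightarrow> W \<subseteq> U)"
    by (rule choice[THEN exE])
  define meet where "meet \<U> \<V> = {U \<inter> V | U V. U \<in> \<U> \<and> V \<in> \<V>}" for \<U> \<V> :: "'a set set"
  have meet: "cov (meet \<U> \<V>)" if covs: "cov \<U>" "cov \<V>" for \<U> \<V>
    unfolding cov_def
  proof
    show "\<forall>U\<in>meet \<U> \<V>. openin X U"
      using that by (auto simp: cov_def meet_def)
    show "topspace X \<subseteq> \<Union>(meet \<U> \<V>)"
    proof
      fix x assume x: "x \<in> topspace X"
      obtain U V where "U \<in> \<U>" "x \<in> U" "V \<in> \<V>" "x \<in> V"
        using covs x unfolding cov_def by (meson UnionE subsetD)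
      then show "x \<in> \<Union>(meet \<U> \<V>)" unfolding meet_def by blast
    qed
  qed
  define \<U> where "\<U> = rec_nat {topspace X} (\<lambda>n \<W>. B (meet \<W> (\<D> n)))"
  have U0: "\<U> 0 = {topspace X}" and US: "\<U> (Suc n) = B (meet (\<U> n) (\<D> n))" for n
    by (simp_all add: \<U>_def)
  have covD: "cov (\<D> n)" for n using op cover by (simp add: cov_def)
  have cov: "cov (\<U> n)" for n
  proof (induction n)
    case 0
    show ?case by (simp add: cov_def U0)
  next
    case (Suc n)
    show ?case unfolding US using B meet[OF Suc covD] by blast
  qed
  have sub: "W \<subseteq> topspace X" if "W \<in> \<U> n" for W n
    using cov[of n] that openin_subset unfolding cov_def by blast
  have ref: "\<exists>U\<in>\<U> n. \<exists>V\<in>\<D> n. \<forall>W\<in>\<U> (Suc n). z \<in> W \<longrightarrow> W \<subseteq> U \<and> W \<subseteq> V" if z: "z \<in> topspace X" for z n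
  proof -
    have "\<forall>z\<in>topspace X. \<exists>M\<in>meet (\<U> n) (\<D> n). \<forall>W\<in>\<U> (Suc n). z \<in> W \<longrightarrow> W \<subseteq> M"
      unfolding US using B meet[OF cov covD] by simp
    then have "\<exists>M\<in>meet (\<U> n) (\<D> n). \<forall>W\<in>\<U> (Suc n). z \<in> W \<longrightarrow> W \<subseteq> M"
      using z by (rule bspec)
    then obtain M where M: "M \<in> meet (\<U> n) (\<D> n)" "\<forall>W\<in>\<U> (Suc n). z \<in> W \<longrightarrow> W \<subseteq> M"
      by (rule bexE)
    then obtain U V where "U \<in> \<U> n" "V \<in> \<D> n" "M = U \<inter> V" by (auto simp: meet_def)
    then show ?thesis using M(2) by (intro bexI[of _ U] bexI[of _ V]) auto
  qed
  have refU: "\<exists>U\<in>\<U> n. \<forall>W\<in>\<U> (Suc n). z \<in> W \<longrightarrow> W \<subseteq> U"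
    and refD: "\<exists>V\<in>\<D> n. \<forall>W\<in>\<U> (Suc n). z \<in> W \<longrightarrow> W \<subseteq> V" if W': "W' \<in> \<U> (Suc n)" "z \<in> W'" for W' z n
  proof -
    obtain U where U: "U \<in> \<U> n" "\<exists>V\<in>\<D> n. \<forall>W\<in>\<U> (Suc n). z \<in> W \<longrightarrow> W \<subseteq> U \<and> W \<subseteq> V"
      using ref[OF subsetD[OF sub[OF W'(1)] W'(2)], of n] by (rule bexE)
    obtain V where V: "V \<in> \<D> n" "\<forall>W\<in>\<U> (Suc n). z \<in> W \<longrightarrow> W \<subseteq> U \<and> W \<subseteq> V"
      using U(2) by (rule bexE)
    show "\<exists>U\<in>\<U> n. \<forall>W\<in>\<U> (Suc n). z \<in> W \<longrightarrow> W \<subseteq> U"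
      using V(2) by (intro bexI[OF _ U(1)]) simp
    show "\<exists>V\<in>\<D> n. \<forall>W\<in>\<U> (Suc n). z \<in> W \<longrightarrow> W \<subseteq> V"
      using V(2) by (intro bexI[OF _ V(1)]) simp
  qed
  \<comment> \<open>The disjunct x = y makes the relations reflexive also outside the carrier of the space.\<close>
  define E where "E n x y \<longleftrightarrow> x = y \<or> (\<exists>W\<in>\<U> n. x \<in> W \<and> y \<in> W)" for n x y
  have down: "E n x y" if xy: "E (Suc n) x y" for n x y
  proof (cases "x = y")
    case False
    then obtain W where W: "W \<in> \<U> (Suc n)" "x \<in> W" "y \<in> W" using xy by (auto simp: E_def)
    obtain U where "U \<in> \<U> n" "\<forall>W\<in>\<U> (Suc n). x \<in> W \<longrightarrow> W \<subseteq> U" using refU[OF W(1,2)] by (rule bexE)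
    then show ?thesis using W unfolding E_def by blast
  qed (simp add: E_def)
  show ?thesis
  proof (rule metrizable_space_if_entourages[of X E, OF t1])
    show "E n x x" for n x by (simp add: E_def)
    show "E n x y \<Longrightarrow> E n y x" for n x y by (auto simp: E_def)
    show "E n x z" if xy: "E (Suc n) x y" and yz: "E (Suc n) y z" for n x y z
    proof (cases "x = y \<or> y = z")
      case True
      then show ?thesis using down xy yz by auto
    next
      case False
      then obtain W W' where W: "W \<in> \<U> (Suc n)" "x \<in> W" "y \<in> W" "W' \<in> \<U> (Suc n)" "y \<in> W'" "z \<in> W'"
        using xy yz by (auto simp: E_def)
      obtain U where "U \<in> \<U> n" "\<forall>W\<in>\<U> (Suc n). y \<in> W \<longrightarrow> W \<subseteq> U" using refU[OF W(1,3)] by (rule bexE)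
      then show ?thesis using W unfolding E_def by blast
    qed
    show "\<exists>U. openin X U \<and> x \<in> U \<and> (\<forall>y\<in>U. E n x y)" if x: "x \<in> topspace X" for n x
    proof -
      have "x \<in> \<Union>(\<U> n)" using cov[of n] x unfolding cov_def by (meson subsetD)
      then obtain W where "W \<in> \<U> n" "x \<in> W" by (rule UnionE)
      moreover have "openin X W" using calculation cov[of n] by (simp add: cov_def)
      ultimately show ?thesis unfolding E_def by blast
    qed
    show "\<exists>n. \<forall>y\<in>topspace X. E n x y \<longrightarrow> y \<in> T" if T: "openin X T" "x \<in> T" for T x
    proof -
      obtain n where n: "\<forall>V\<in>\<D> n. x \<in> V \<longrightarrow> V \<subseteq> T" using base[OF T] by (rule exE)
      have "y \<in> T" if xy: "E (Suc n) x y" for y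
      proof (cases "x = y")
        case False
        then obtain W where W: "W \<in> \<U> (Suc n)" "x \<in> W" "y \<in> W" using xy by (auto simp: E_def)
        obtain V where "V \<in> \<D> n" "\<forall>W\<in>\<U> (Suc n). x \<in> W \<longrightarrow> W \<subseteq> V" using refD[OF W(1,2)] by (rule bexE)
        then show ?thesis using n W by blast
      qed (use T in simp)
      then show ?thesis by blast
    qed
  qed
qed

section \<open>Countable intersections of neighbourhoods\<close>

text \<open>
  If the conclusion fails, then \<open>x\<close> is a limit from the left and no point to the left of \<open>x\<close> lies in
  all \<open>W n\<close>, where \<open>W n\<close> is a convex neighbourhood inside \<open>V n\<close>. By convexity the left part of a
  \<open>W n\<close> that misses \<open>s\<close> lies between \<open>s\<close> and \<open>x\<close>, so these left parts form a countable local \<open>\<pi>\<close>-base.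
\<close>

lemma countable_intersection_below:
  assumes npi: "\<And>U :: nat \<Rightarrow> 'a set. (\<And>n. openin X (U n)) \<Longrightarrow> (\<And>n. U n \<noteq> {}) \<Longrightarrow>
      \<exists>T. openin X T \<and> x \<in> T \<and> (\<forall>n. \<not> U n \<subseteq> T)"
    and x: "x \<in> topspace X"
    and V: "\<And>n::nat. openin X (V n)" "\<And>n. x \<in> V n"
  shows "\<exists>N. openin X N \<and> x \<in> N \<and> (\<forall>z\<in>N. z \<sqsubseteq> x \<longrightarrow> (\<forall>n. z \<in> V n))"
proof -
  have "\<forall>n. \<exists>W. openin X W \<and> x \<in> W \<and> W \<subseteq> V n \<and> order_convex X (\<sqsubseteq>) W"
    using convex_base[OF V(1) V(2)] by simp
  then obtain W where W': "\<forall>n. openin X (W n) \<and> x \<in> W n \<and> W n \<subseteq> V n \<and> order_convex X (\<sqsubseteq>) (W n)"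
    by (rule choice[THEN exE])
  then have W: "openin X (W n)" "x \<in> W n" "W n \<subseteq> V n" "order_convex X (\<sqsubseteq>) (W n)" for n
    by simp_all
  consider (isolated) T where "openin X T" "x \<in> T" "\<forall>z\<in>T. \<not> z \<sqsubset> x"
    | (bounded) s where "s \<in> topspace X" "s \<sqsubset> x" "\<forall>n. s \<in> W n"
    | (pi) "\<forall>T. openin X T \<longrightarrow> x \<in> T \<longrightarrow> (\<exists>z\<in>T. z \<sqsubset> x)"
           "\<forall>s\<in>topspace X. s \<sqsubset> x \<longrightarrow> (\<exists>n. s \<notin> W n)"
    by metis
  then show ?thesis
  proof cases
    case (isolated T)
    have "z \<in> V n" if "z \<in> T" "z \<sqsubseteq> x" for z n
      using isolated(3) that V(2) le_less by auto
    then show ?thesis using isolated(1,2) by blast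
  next
    case (bounded s)
    have "z \<in> V n" if z: "z \<in> topspace X" "s \<sqsubset> z" "z \<sqsubseteq> x" for z n
    proof -
      have "z \<in> W n"
        using W(4) _ W(2) z(1) less_imp_le[OF z(2)] z(3)
        by (rule order_convexD) (use bounded(3) in simp)
      then show ?thesis using W(3) by blast
    qed
    then show ?thesis
      using open_above[OF bounded(1)] bounded(2) x by (intro exI[of _ "{z \<in> topspace X. s \<sqsubset> z}"]) auto
  next
    case pi
    define U where "U n = W n \<inter> {z \<in> topspace X. z \<sqsubset> x}" for n
    have sub: "W n \<subseteq> topspace X" for n using W(1) by (rule openin_subset)
    have "openin X (U n)" for n
      unfolding U_def using W(1) open_below[OF x] by (rule openin_Int)
    moreover have "U n \<noteq> {}" for n
    proof -
      obtain z where "z \<in> W n" "z \<sqsubset> x" using pi(1) W(1,2) by blast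
      then show ?thesis using sub unfolding U_def by blast
    qed
    ultimately obtain T where T: "openin X T" "x \<in> T" "\<forall>n. \<not> U n \<subseteq> T" using npi by metis
    obtain T' where T': "openin X T' \<and> x \<in> T' \<and> T' \<subseteq> T \<and> order_convex X (\<sqsubseteq>) T'"
      using convex_base[OF T(1,2)] by (rule exE)
    then obtain s where s: "s \<in> T'" "s \<sqsubset> x" using pi(1) by blast
    then have sX: "s \<in> topspace X" using T' openin_subset by blast
    then obtain n where n: "s \<notin> W n" using pi(2) s by blast
    have "z \<in> T'" if z: "z \<in> U n" for z
    proof -
      have z': "z \<in> W n" "z \<sqsubset> x" "z \<in> topspace X" using z by (simp_all add: U_def)
      have "\<not> z \<sqsubseteq> s"
        using order_convexD[OF W(4) z'(1) W(2) sX _ less_imp_le[OF s(2)]] n by blast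
      then have "s \<sqsubseteq> z" using linear by blast
      then show ?thesis
        using order_convexD[of X "(\<sqsubseteq>)" T' s x z] T' s(1) z'(3) less_imp_le[OF z'(2)] by blast
    qed
    then have "U n \<subseteq> T" using T' by blast
    then show ?thesis using T(3) by blast
  qed
qed

lemma P_space_if_no_countable_local_pi_base:
  assumes npi: "\<And>x U. x \<in> topspace X \<Longrightarrow> (\<And>n::nat. openin X (U n)) \<Longrightarrow> (\<And>n. U n \<noteq> {}) \<Longrightarrow>
      \<exists>T. openin X T \<and> x \<in> T \<and> (\<forall>n. \<not> U n \<subseteq> T)"
  shows "P_space X"
  unfolding P_space_def
proof (intro allI impI)
  fix S assume "gdelta_in X S"
  then obtain V where V: "\<And>n::nat. openin X (V n)" and S: "\<Inter>(range V) = S"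
    unfolding gdelta_in_descending by blast
  show "openin X S"
  proof (subst openin_subopen, intro ballI)
    fix x assume "x \<in> S"
    then have xV: "\<And>n. x \<in> V n" using S by blast
    then have x: "x \<in> topspace X" using V openin_subset by blast
    obtain N where N: "openin X N \<and> x \<in> N \<and> (\<forall>z\<in>N. z \<sqsubseteq> x \<longrightarrow> (\<forall>n. z \<in> V n))"
      using countable_intersection_below[OF npi[OF x] x V xV] by (rule exE)
    obtain M where M: "openin X M \<and> x \<in> M \<and> (\<forall>z\<in>M. x \<sqsubseteq> z \<longrightarrow> (\<forall>n. z \<in> V n))"
      using suborderable.countable_intersection_below[OF dual npi[OF x] x V xV] by (rule exE)
    have "N \<inter> M \<subseteq> S"
      using N M linear S by blast
    then show "\<exists>T. openin X T \<and> x \<in> T \<and> T \<subseteq> S" using N M by (intro exI[of _ "N \<inter> M"]) auto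
  qed
qed

end

text \<open>
  Regularity gives a sequence of open sets \<open>W n\<close> around \<open>x\<close> with closed sets \<open>K n\<close> squeezed in between.
  Their common intersection is closed, and it is a \<open>G\<^sub>\<delta>\<close>-set, hence open.
\<close>

lemma regular_P_space_clopen_base:
  assumes reg: "regular_space X" and P: "P_space X" and U: "openin X U" "x \<in> U"
  shows "\<exists>S. openin X S \<and> closedin X S \<and> x \<in> S \<and> S \<subseteq> U"
proof -
  have "\<forall>W. \<exists>A. openin X W \<and> x \<in> W \<longrightarrow>
      openin X A \<and> (\<exists>K. closedin X K \<and> x \<in> A \<and> A \<subseteq> K \<and> K \<subseteq> W)"
    using reg unfolding neighbourhood_base_of_closedin[symmetric] neighbourhood_base_of by metis
  then obtain s where s: "\<forall>W. openin X W \<and> x \<in> W \<longrightarrow>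
      openin X (s W) \<and> (\<exists>K. closedin X K \<and> x \<in> s W \<and> s W \<subseteq> K \<and> K \<subseteq> W)"
    by (rule choice[THEN exE])
  define W where "W n = (s ^^ n) U" for n
  have WS: "W (Suc n) = s (W n)" for n by (simp add: W_def)
  have W: "openin X (W n) \<and> x \<in> W n" for n
    by (induction n) (use U s in \<open>auto simp: W_def\<close>)
  have "\<forall>n. \<exists>K. closedin X K \<and> W (Suc n) \<subseteq> K \<and> K \<subseteq> W n"
  proof
    fix n
    show "\<exists>K. closedin X K \<and> W (Suc n) \<subseteq> K \<and> K \<subseteq> W n"
      using s[THEN spec, THEN mp, OF W[of n]] unfolding WS by blast
  qed
  then obtain K where K: "\<forall>n. closedin X (K n) \<and> W (Suc n) \<subseteq> K n \<and> K n \<subseteq> W n"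
    by (rule choice[THEN exE])
  have dec: "W (Suc n) \<subseteq> W n" for n using K by blast
  define S where "S = \<Inter>(range W)"
  have SK: "S = \<Inter>(range K)"
  proof
    show "S \<subseteq> \<Inter>(range K)" using K unfolding S_def by blast
    show "\<Inter>(range K) \<subseteq> S" using K unfolding S_def by blast
  qed
  have "gdelta_in X S"
    unfolding gdelta_in_descending S_def using W dec by blast
  then have "openin X S" using P by (simp add: P_space_def)
  moreover have "closedin X S" unfolding SK using K by (intro closedin_Inter) auto
  moreover have "x \<in> S" using W by (simp add: S_def)
  moreover have "S \<subseteq> U" unfolding S_def using W_def[of 0] by auto
  ultimately show ?thesis by blast
qed

lemma regular_P_space_totally_disconnected:
  assumes t1: "t1_space X" and "regular_space X" "P_space X"
  shows "totally_disconnected_space X"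
  unfolding totally_disconnected_space_def
proof
  fix C assume C: "C \<in> connected_components_of X"
  have conn: "connectedin X C" and ne: "C \<noteq> {}"
    using C connectedin_connected_components_of nonempty_connected_components_of by auto
  obtain x where x: "x \<in> C" using ne by blast
  have "y = x" if y: "y \<in> C" for y
  proof (rule ccontr)
    assume "y \<noteq> x"
    moreover have "x \<in> topspace X" "y \<in> topspace X"
      using conn x y connectedin_subset_topspace by blast+
    ultimately obtain U where U: "openin X U" "x \<in> U" "y \<notin> U"
      using t1 unfolding t1_space_def by metis
    obtain S where S: "openin X S \<and> closedin X S \<and> x \<in> S \<and> S \<subseteq> U"
      using regular_P_space_clopen_base[OF assms(2,3) U(1,2)] by (rule exE)
    then have "C \<subseteq> S \<or> disjnt C S" using connectedin_clopen_cases[OF conn] by blast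
    then show False using S x y U(3) by (auto simp: disjnt_iff)
  qed
  then have "C = {x}" using x by blast
  then show "\<exists>x. C = {x}" ..
qed

section \<open>Orders on subspaces of linearly ordered spaces\<close>

lemma linear_order_on_props:
  assumes "linear_order_on A r"
  shows "a \<in> A \<Longrightarrow> (a, a) \<in> r"
    and "(a, b) \<in> r \<Longrightarrow> (b, c) \<in> r \<Longrightarrow> (a, c) \<in> r"
    and "(a, b) \<in> r \<Longrightarrow> (b, a) \<in> r \<Longrightarrow> a = b"
    and "a \<in> A \<Longrightarrow> b \<in> A \<Longrightarrow> (a, b) \<in> r \<or> (b, a) \<in> r"
proof -
  have r: "refl_on A r" "trans r" "antisym r" "total_on A r"
    using assms by (simp_all add: order_on_defs)
  show "a \<in> A \<Longrightarrow> (a, a) \<in> r" using r(1) by (rule refl_onD)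
  show "(a, b) \<in> r \<Longrightarrow> (b, c) \<in> r \<Longrightarrow> (a, c) \<in> r" using r(2) by (rule transD)
  show "(a, b) \<in> r \<Longrightarrow> (b, a) \<in> r \<Longrightarrow> a = b" using r(3) by (rule antisymD)
  show "a \<in> A \<Longrightarrow> b \<in> A \<Longrightarrow> (a, b) \<in> r \<or> (b, a) \<in> r"
    using r(1,4) by (cases "a = b") (auto simp: total_on_def dest: refl_onD)
qed

text \<open>
  The generators are convex, and convexity is inherited by intersections; unions need only
  a member around the given point.
\<close>

lemma lots_topology_convex_base:
  assumes lin: "linear_order_on L r" and "openin (lots_topology L r) U" "x \<in> U"
  shows "\<exists>V. openin (lots_topology L r) V \<and> x \<in> V \<and> V \<subseteq> U \<and>
    (\<forall>a\<in>V. \<forall>b\<in>V. \<forall>c\<in>L. (a, c) \<in> r \<longrightarrow> (c, b) \<in> r \<longrightarrow> c \<in> V)"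
proof -
  let ?B = "insert L
       ((\<lambda>a. {x \<in> L. (x, a) \<in> r \<and> x \<noteq> a}) ` L \<union>
        (\<lambda>a. {x \<in> L. (a, x) \<in> r \<and> x \<noteq> a}) ` L)"
  have tr: "\<And>a b c. (a, b) \<in> r \<Longrightarrow> (b, c) \<in> r \<Longrightarrow> (a, c) \<in> r"
    and as: "\<And>a b. (a, b) \<in> r \<Longrightarrow> (b, a) \<in> r \<Longrightarrow> a = b"
    using linear_order_on_props(2,3)[OF lin] by metis+
  have "generate_topology_on ?B U"
    using assms(2) unfolding lots_topology_def openin_topology_generated_by_iff .
  then show ?thesis using assms(3)
  proof (induction arbitrary: x)
    case Empty
    then show ?case by simp
  next
    case (Int a b)
    obtain V where V: "openin (lots_topology L r) V \<and> x \<in> V \<and> V \<subseteq> a \<and>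
      (\<forall>a\<in>V. \<forall>b\<in>V. \<forall>c\<in>L. (a, c) \<in> r \<longrightarrow> (c, b) \<in> r \<longrightarrow> c \<in> V)"
      using Int.IH(1)[of x] Int.prems by auto
    obtain W where W: "openin (lots_topology L r) W \<and> x \<in> W \<and> W \<subseteq> b \<and>
      (\<forall>a\<in>W. \<forall>b\<in>W. \<forall>c\<in>L. (a, c) \<in> r \<longrightarrow> (c, b) \<in> r \<longrightarrow> c \<in> W)"
      using Int.IH(2)[of x] Int.prems by auto
    have "\<forall>a\<in>V \<inter> W. \<forall>b\<in>V \<inter> W. \<forall>c\<in>L. (a, c) \<in> r \<longrightarrow> (c, b) \<in> r \<longrightarrow> c \<in> V \<inter> W"
    proof (intro ballI impI IntI)
      fix a b c assume "a \<in> V \<inter> W" "b \<in> V \<inter> W" "c \<in> L" "(a, c) \<in> r" "(c, b) \<in> r"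
      then show "c \<in> V" "c \<in> W" using V W by blast+
    qed
    moreover have "openin (lots_topology L r) (V \<inter> W)" using V W by (simp add: openin_Int)
    moreover have "x \<in> V \<inter> W" using V W by blast
    moreover have "V \<inter> W \<subseteq> a \<inter> b" using V W by blast
    ultimately show ?case by (intro exI[of _ "V \<inter> W"] conjI)
  next
    case (UN K)
    then obtain k where k: "k \<in> K" "x \<in> k" by blast
    obtain V where "openin (lots_topology L r) V \<and> x \<in> V \<and> V \<subseteq> k \<and>
      (\<forall>a\<in>V. \<forall>b\<in>V. \<forall>c\<in>L. (a, c) \<in> r \<longrightarrow> (c, b) \<in> r \<longrightarrow> c \<in> V)"
      using UN.IH[OF k] by (rule exE)
    moreover from this have "V \<subseteq> \<Union>K" using k(1) by blast
    ultimately show ?case by (intro exI[of _ V] conjI) blast+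
  next
    case (Basis S)
    have "openin (lots_topology L r) S"
      unfolding lots_topology_def openin_topology_generated_by_iff
      using Basis.hyps by (rule generate_topology_on.Basis)
    moreover have "\<forall>a\<in>S. \<forall>b\<in>S. \<forall>c\<in>L. (a, c) \<in> r \<longrightarrow> (c, b) \<in> r \<longrightarrow> c \<in> S"
    proof (intro ballI impI)
      fix a b c assume *: "a \<in> S" "b \<in> S" "c \<in> L" "(a, c) \<in> r" "(c, b) \<in> r"
      consider "S = L" | l where "S = {x \<in> L. (x, l) \<in> r \<and> x \<noteq> l}"
        | l where "S = {x \<in> L. (l, x) \<in> r \<and> x \<noteq> l}"
        using Basis.hyps by auto
      then show "c \<in> S"
      proof cases
        case 1
        then show ?thesis using * by simp
      next
        case (2 l)
        then show ?thesis using * tr as by (metis (mono_tags, lifting) mem_Collect_eq)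
      next
        case (3 l)
        then show ?thesis using * tr as by (metis (mono_tags, lifting) mem_Collect_eq)
      qed
    qed
    ultimately show ?case using Basis.prems by blast
  qed
qed

text \<open>
  The order is pulled back along the embedding \<open>h\<close>. Points outside the carrier of \<open>X\<close> are put below
  it and ordered by an arbitrary well-order, so that the order is total on the type.
\<close>

lemma GO_space_imp_suborderable:
  fixes X :: "'a topology"
  assumes "GO_space TYPE('b) X"
  shows "\<exists>le lt. suborderable le lt X"
proof -
  obtain L :: "'b set" and r S where lin: "linear_order_on L r" and SL: "S \<subseteq> L"
    and "X homeomorphic_space subtopology (lots_topology L r) S"
    using assms unfolding GO_space_def by blast
  then obtain h where h: "homeomorphic_map X (subtopology (lots_topology L r) S) h"
    unfolding homeomorphic_space by blast
  let ?T = "lots_topology L r"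
  let ?M = "topspace X"
  have TL: "topspace ?T = L" unfolding lots_topology_def by auto
  have inj: "inj_on h ?M" and img: "h ` ?M = S"
    using homeomorphic_imp_injective_map[OF h] homeomorphic_imp_surjective_map[OF h] TL SL by auto
  have hL: "h x \<in> L" if "x \<in> ?M" for x using img SL that by blast
  have cont: "continuous_map X ?T h"
    using homeomorphic_imp_continuous_map[OF h] by (simp add: continuous_map_in_subtopology)
  have pre: "openin X {x \<in> ?M. h x \<in> V}" if "openin ?T V" for V
    using cont that by (rule openin_continuous_map_preimage)
  obtain w :: "'a rel" where "well_order_on UNIV w" using well_order_on by blast
  then have w: "linear_order_on UNIV w" by (simp add: well_order_on_def)
  note r = linear_order_on_props[OF lin]
  note w = linear_order_on_props[OF w, simplified]
  define le where "le x y \<longleftrightarrow> (if x \<in> ?M then y \<in> ?M \<and> (h x, h y) \<in> r else y \<in> ?M \<or> (x, y) \<in> w)" for x y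
  define lt where "lt x y \<longleftrightarrow> le x y \<and> \<not> le y x" for x y
  have le_M: "le x y \<longleftrightarrow> (h x, h y) \<in> r" if "x \<in> ?M" "y \<in> ?M" for x y
    using that by (simp add: le_def)
  have lt_M: "lt x y \<longleftrightarrow> (h x, h y) \<in> r \<and> h x \<noteq> h y" if "x \<in> ?M" "y \<in> ?M" for x y
    using that r(1,3) hL unfolding lt_def le_M[OF that] le_M[OF that(2,1)] by metis
  have "class.linorder le lt"
  proof
    show "lt x y = (le x y \<and> \<not> le y x)" for x y by (simp add: lt_def)
    show "le x x" for x using r(1) hL w(1) by (simp add: le_def)
    show "le x z" if "le x y" "le y z" for x y z
      using that r(2) w(2) unfolding le_def by metis
    show "x = y" if "le x y" "le y x" for x y
      using that r(3) w(3) inj unfolding le_def by (metis inj_onD)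
    show "le x y \<or> le y x" for x y
      using r(4) w(4) hL unfolding le_def by metis
  qed
  moreover have "suborderable_axioms le lt X"
  proof
    fix a assume a: "a \<in> ?M"
    have gen: "openin ?T A" if "A \<in> insert L
       ((\<lambda>a. {x \<in> L. (x, a) \<in> r \<and> x \<noteq> a}) ` L \<union>
        (\<lambda>a. {x \<in> L. (a, x) \<in> r \<and> x \<noteq> a}) ` L)" for A
      unfolding lots_topology_def openin_topology_generated_by_iff
      using that by (rule generate_topology_on.Basis)
    have "openin ?T {x \<in> L. (x, h a) \<in> r \<and> x \<noteq> h a}" by (rule gen) (use hL[OF a] in blast)
    moreover have "{x \<in> ?M. lt x a} = {x \<in> ?M. h x \<in> {y \<in> L. (y, h a) \<in> r \<and> y \<noteq> h a}}"
      by (intro Collect_cong conj_cong refl) (use hL lt_M a in auto)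
    ultimately show "openin X {x \<in> ?M. lt x a}" using pre by (simp only:)
    have "openin ?T {x \<in> L. (h a, x) \<in> r \<and> x \<noteq> h a}" by (rule gen) (use hL[OF a] in blast)
    moreover have "{x \<in> ?M. lt a x} = {x \<in> ?M. h x \<in> {y \<in> L. (h a, y) \<in> r \<and> y \<noteq> h a}}"
      by (intro Collect_cong conj_cong refl) (use hL lt_M a in auto)
    ultimately show "openin X {x \<in> ?M. lt a x}" using pre by (simp only:)
  next
    fix U x assume U: "openin X U" "x \<in> U"
    have UM: "U \<subseteq> ?M" using U(1) by (rule openin_subset)
    have "openin (subtopology ?T S) (h ` U)"
      using homeomorphic_map_openness[OF h UM] U(1) by simp
    then obtain T where T: "openin ?T T" "h ` U = T \<inter> S" unfolding openin_subtopology by blast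
    have hx: "h x \<in> T" using U(2) T(2) by blast
    obtain V where V: "openin ?T V \<and> h x \<in> V \<and> V \<subseteq> T \<and>
        (\<forall>a\<in>V. \<forall>b\<in>V. \<forall>c\<in>L. (a, c) \<in> r \<longrightarrow> (c, b) \<in> r \<longrightarrow> c \<in> V)"
      using lots_topology_convex_base[OF lin T(1) hx] by (rule exE)
    let ?V = "{y \<in> ?M. h y \<in> V}"
    have "openin X ?V" using pre V by blast
    moreover have "x \<in> ?V" using U UM V by blast
    moreover have "?V \<subseteq> U"
    proof
      fix y assume y: "y \<in> ?V"
      then have "h y \<in> h ` U" using V T(2) img by blast
      then obtain u where u: "u \<in> U" "h y = h u" by blast
      then have "y = u" using inj_onD[OF inj, of y u] y UM by blast
      then show "y \<in> U" using u by simp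
    qed
    moreover have "order_convex X le ?V"
      unfolding order_convex_def
    proof (intro ballI impI)
      fix a b c assume *: "a \<in> ?V" "b \<in> ?V" "c \<in> ?M" "le a c" "le c b"
      then have "(h a, h c) \<in> r" "(h c, h b) \<in> r" using le_M by simp_all
      then have "h c \<in> V" using V *(1,2) hL[OF *(3)] by blast
      then show "c \<in> ?V" using *(3) by simp
    qed
    ultimately show "\<exists>V. openin X V \<and> x \<in> V \<and> V \<subseteq> U \<and> order_convex X le V"
      by (intro exI[of _ ?V] conjI)
  qed
  ultimately have "suborderable le lt X" by (rule suborderable.intro)
  then show ?thesis by blast
qed

section \<open>Rectifiable suborderable spaces\<close>

theorem theorem3p10:
  fixes G :: "'a topology"
  assumes "t1_space G" and "regular_space G"
    and "GO_space TYPE('b) G"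
    and "rectifiable_space G"
  shows "metrizable_space G \<or> (totally_disconnected_space G \<and> P_space G)"
proof (cases "\<exists>x\<in>topspace G. \<exists>U :: nat \<Rightarrow> 'a set. (\<forall>n. openin G (U n) \<and> U n \<noteq> {}) \<and>
    (\<forall>T. openin G T \<longrightarrow> x \<in> T \<longrightarrow> (\<exists>n. U n \<subseteq> T))")
  case True
  then obtain x U where x: "x \<in> topspace G" and U: "\<And>n::nat. openin G (U n)" "\<And>n. U n \<noteq> {}"
    and pi: "\<And>T. openin G T \<Longrightarrow> x \<in> T \<Longrightarrow> \<exists>n. U n \<subseteq> T"
    by metis
  obtain \<D> :: "nat \<Rightarrow> 'a set set" where D: "(\<forall>n. (\<forall>V\<in>\<D> n. openin G V) \<and> topspace G \<subseteq> \<Union>(\<D> n)) \<and>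
    (\<forall>T x. openin G T \<longrightarrow> x \<in> T \<longrightarrow> (\<exists>n. \<forall>V\<in>\<D> n. x \<in> V \<longrightarrow> V \<subseteq> T))"
    using rectifiable_space_development[OF assms(4) x U pi] by (rule exE)
  obtain le lt where "suborderable le lt G" using GO_space_imp_suborderable[OF assms(3)] by blast
  then have "metrizable_space G"
    by (rule suborderable.metrizable_if_development[OF _ assms(1), of _ _ \<D>]) (use D in simp_all)
  then show ?thesis ..
next
  case False
  obtain le lt where sub: "suborderable le lt G" using GO_space_imp_suborderable[OF assms(3)] by blast
  have "P_space G"
  proof (rule suborderable.P_space_if_no_countable_local_pi_base[OF sub])
    show "\<exists>T. openin G T \<and> x \<in> T \<and> (\<forall>n. \<not> U n \<subseteq> T)"
      if "x \<in> topspace G" "\<And>n. openin G (U n)" "\<And>n. U n \<noteq> {}" for x and U :: "nat \<Rightarrow> 'a set"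
      using False that by metis
  qed
  then show ?thesis using regular_P_space_totally_disconnected[OF assms(1,2)] by blast
qed

end
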